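(* For every integer $n>1$, the relation on closed, connected Legendrian submanifolds of $\mathbb{R}^{2n+1}_{st}$, considered up to Legendrian isotopy, under which $\Lambda_-$ is related to $\Lambda_+$ if and only if there exists an exact Lagrangian cobordism from $\Lambda_-$ to $\Lambda_+$ in the symplectization of $\mathbb{R}^{2n+1}_{st}$, is not anti-symmetric, and hence is not a partial order.
   Context: For $n\geq 1$, $\mathbb{R}^{2n+1}_{st}$ denotes $\mathbb{R}^{2n+1}$ with coordinates $(x_1,y_1,\dots,x_n,y_n,z)$ and the contact form $\alpha=dz-\sum_{i=1}^n y_i\,dx_i$ (written $dz-y\,dx$). A Legendrian submanifold is an $n$-dimensional submanifold on which $\alpha$ vanishes; closed means compact without boundary. Two closed Legendrian submanifolds are Legendrian isotopic if they are joined by a smooth isotopy through Legendrian submanifolds. The symplectization of $\mathbb{R}^{2n+1}_{st}$ is $(\mathbb{R}\times\mathbb{R}^{2n+1}, d(e^t\alpha))$, where $t$ is the coordinate on the first factor. Let $\Lambda_-,\Lambda_+$ be closed, connected Legendrian submanifolds of $\mathbb{R}^{2n+1}_{st}$. An exact Lagrangian cobordism from $\Lambda_-$ to $\Lambda_+$ is a properly embedded $(n+1)$-dimensional submanifold $L\subset\mathbb{R}\times\mathbb{R}^{2n+1}$ without boundary for which there is $T>0$ such that (i) $L\cap((-\infty,-T]\times\mathbb{R}^{2n+1})=(-\infty,-T]\times\Lambda_-$ and $L\cap([T,\infty)\times\mathbb{R}^{2n+1})=[T,\infty)\times\Lambda_+$; (ii) $L\cap([-T,T]\times\mathbb{R}^{2n+1})$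 is compact; (iii) there is a smooth function $f:L\to\mathbb{R}$ with $e^t\alpha|_L=df$ that is constant on $(-\infty,-T]\times\Lambda_-$ and constant on $[T,\infty)\times\Lambda_+$ (so in particular $L$ is Lagrangian). No restriction is placed on the topology of $L$. Anti-symmetry means: if there are exact Lagrangian cobordisms from $\Lambda_-$ to $\Lambda_+$ and from $\Lambda_+$ to $\Lambda_-$, then $\Lambda_-$ and $\Lambda_+$ are Legendrian isotopic. *)

theory Defs
  imports "HOL-Analysis.Analysis"
begin

section \<open>Smooth maps and embedded submanifolds of Euclidean spaces\<close>

primrec ck_on :: "nat \<Rightarrow> 'a::euclidean_space set \<Rightarrow> ('a \<Rightarrow> 'b::euclidean_space) \<Rightarrow> bool" where
  "ck_on 0 U f \<longleftrightarrow> continuous_on U f"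
| "ck_on (Suc k) U f \<longleftrightarrow>
     f differentiable_on U \<and> (\<forall>v. ck_on k U (\<lambda>x. frechet_derivative f (at x) v))"

text \<open>Only meaningful for open \<open>U\<close>; for other sets use \<open>smooth_map_on\<close> below.\<close>

definition smooth_on_open :: "'a::euclidean_space set \<Rightarrow> ('a \<Rightarrow> 'b::euclidean_space) \<Rightarrow> bool" where
  "smooth_on_open U f \<longleftrightarrow> open U \<and> (\<forall>k. ck_on k U f)"

text \<open>A map on an arbitrary subset of a Euclidean space is smooth if it locally extends to a
  smooth map on an open set. On an embedded submanifold \<open>M\<close>, and on \<open>{0..1} \<times> M\<close>, this is
  smoothness in charts.\<close>

definition smooth_map_on :: "'a::euclidean_space set \<Rightarrow> ('a \<Rightarrow> 'b::euclidean_space) \<Rightarrow> bool" where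
  "smooth_map_on S f \<longleftrightarrow>
     (\<forall>p\<in>S. \<exists>U g. p \<in> U \<and> smooth_on_open U g \<and> (\<forall>x\<in>S \<inter> U. g x = f x))"

definition diffeomorphism_between ::
  "'a::euclidean_space set \<Rightarrow> 'b::euclidean_space set \<Rightarrow> ('a \<Rightarrow> 'b) \<Rightarrow> bool" where
  "diffeomorphism_between S T f \<longleftrightarrow>
     (\<exists>g. homeomorphism S T f g \<and> smooth_map_on S f \<and> smooth_map_on T g)"

text \<open>Embedded \<open>k\<close>-dimensional submanifold without boundary, by slice charts.\<close>

definition submanifold :: "nat \<Rightarrow> 'a::euclidean_space set \<Rightarrow> bool" where
  "submanifold k M \<longleftrightarrow>
     (\<forall>p\<in>M. \<exists>U V (P :: 'a set) \<phi>.
        p \<in> U \<and> open U \<and> open V \<and> diffeomorphism_between U V \<phi> \<and>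
        subspace P \<and> dim P = k \<and> \<phi> ` (M \<inter> U) = P \<inter> V)"

definition tangent_space :: "'a::euclidean_space set \<Rightarrow> 'a \<Rightarrow> 'a set" where
  "tangent_space M p =
     {v. \<exists>\<epsilon>>0. \<exists>\<gamma> :: real \<Rightarrow> 'a.
           smooth_on_open {-\<epsilon><..<\<epsilon>} \<gamma> \<and> \<gamma> ` {-\<epsilon><..<\<epsilon>} \<subseteq> M \<and> \<gamma> 0 = p \<and>
           (\<gamma> has_vector_derivative v) (at 0)}"

text \<open>\<open>df = \<omega>\<close> restricted to \<open>M\<close>. The derivative \<open>D\<close> of \<open>f\<close> at \<open>p\<close> within \<open>M\<close> need not be
  unique, but its restriction to the tangent space of a submanifold is.\<close>

definition differential_is ::
  "'a::euclidean_space set \<Rightarrow> ('a \<Rightarrow> real) \<Rightarrow> ('a \<Rightarrow> 'a \<Rightarrow> real) \<Rightarrow> bool" where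
  "differential_is M f \<omega> \<longleftrightarrow>
     (\<forall>p\<in>M. \<exists>D. (f has_derivative D) (at p within M) \<and>
                (\<forall>v\<in>tangent_space M p. D v = \<omega> p v))"


section \<open>Legendrian submanifolds of the standard contact space\<close>

text \<open>Points of \<open>\<real>\<^sup>2\<^sup>n\<^sup>+\<^sup>1\<close> are triples \<open>(x, y, z)\<close>, with \<open>n = CARD('n)\<close>.\<close>

type_synonym 'n std = "(real ^ 'n) \<times> (real ^ 'n) \<times> real"

definition contact_form :: "'n::finite std \<Rightarrow> 'n std \<Rightarrow> real" where
  "contact_form = (\<lambda>(x, y, z) (dx, dy, dz). dz - (\<Sum>i\<in>UNIV. y $ i * dx $ i))"

definition legendrian :: "'n::finite std set \<Rightarrow> bool" where
  "legendrian \<Lambda> \<longleftrightarrow>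
     submanifold CARD('n) \<Lambda> \<and> (\<forall>p\<in>\<Lambda>. \<forall>v\<in>tangent_space \<Lambda> p. contact_form p v = 0)"

text \<open>Connected manifolds are nonempty by convention, whereas \<open>connected {}\<close> holds in the library.\<close>

definition closed_connected_legendrian :: "'n::finite std set \<Rightarrow> bool" where
  "closed_connected_legendrian \<Lambda> \<longleftrightarrow> legendrian \<Lambda> \<and> compact \<Lambda> \<and> connected \<Lambda> \<and> \<Lambda> \<noteq> {}"

definition legendrian_isotopic :: "'n::finite std set \<Rightarrow> 'n std set \<Rightarrow> bool" where
  "legendrian_isotopic \<Lambda>\<^sub>0 \<Lambda>\<^sub>1 \<longleftrightarrow>
     (\<exists>\<Phi> :: real \<times> 'n std \<Rightarrow> 'n std.
        smooth_map_on ({0..1} \<times> \<Lambda>\<^sub>0) \<Phi> \<and>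
        (\<forall>t\<in>{0..1}. legendrian ((\<lambda>p. \<Phi> (t, p)) ` \<Lambda>\<^sub>0) \<and>
           diffeomorphism_between \<Lambda>\<^sub>0 ((\<lambda>p. \<Phi> (t, p)) ` \<Lambda>\<^sub>0) (\<lambda>p. \<Phi> (t, p))) \<and>
        (\<forall>p\<in>\<Lambda>\<^sub>0. \<Phi> (0, p) = p) \<and>
        (\<lambda>p. \<Phi> (1, p)) ` \<Lambda>\<^sub>0 = \<Lambda>\<^sub>1)"


section \<open>Exact Lagrangian cobordisms in the symplectization\<close>

text \<open>The primitive \<open>e\<^sup>t \<alpha>\<close> of the symplectic form on the symplectization.\<close>

definition liouville_form :: "real \<times> 'n::finite std \<Rightarrow> real \<times> 'n std \<Rightarrow> real" where
  "liouville_form = (\<lambda>(t, p) (dt, v). exp t * contact_form p v)"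

text \<open>A submanifold is properly embedded iff it is a closed subset of the ambient space.
  That \<open>L\<close> is Lagrangian for \<open>d(e\<^sup>t \<alpha>)\<close> is implied by \<open>e\<^sup>t \<alpha>|\<^sub>L = df\<close> and the dimension.\<close>

definition exact_lagrangian_cobordism ::
  "'n::finite std set \<Rightarrow> 'n std set \<Rightarrow> (real \<times> 'n std) set \<Rightarrow> bool" where
  "exact_lagrangian_cobordism \<Lambda>m \<Lambda>p L \<longleftrightarrow>
     submanifold (CARD('n) + 1) L \<and> closed L \<and>
     (\<exists>T>0.
        L \<inter> ({..-T} \<times> UNIV) = {..-T} \<times> \<Lambda>m \<and>
        L \<inter> ({T..} \<times> UNIV) = {T..} \<times> \<Lambda>p \<and>
        compact (L \<inter> ({-T..T} \<times> UNIV)) \<and>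
        (\<exists>f :: real \<times> 'n std \<Rightarrow> real.
           smooth_map_on L f \<and> differential_is L f liouville_form \<and>
           f constant_on ({..-T} \<times> \<Lambda>m) \<and> f constant_on ({T..} \<times> \<Lambda>p)))"


section \<open>The relations on Legendrian submanifolds and on their isotopy classes\<close>

definition legendrian_isotopy_rel :: "'n::finite std set rel" where
  "legendrian_isotopy_rel =
     {(\<Lambda>, \<Lambda>'). closed_connected_legendrian \<Lambda> \<and> closed_connected_legendrian \<Lambda>' \<and>
        legendrian_isotopic \<Lambda> \<Lambda>'}"

definition cobordism_rel :: "'n::finite std set rel" where
  "cobordism_rel =
     {(\<Lambda>m, \<Lambda>p). closed_connected_legendrian \<Lambda>m \<and> closed_connected_legendrian \<Lambda>p \<and>
        (\<exists>L. exact_lagrangian_cobordism \<Lambda>m \<Lambda>p L)}"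

definition legendrian_isotopy_classes :: "'n::finite std set set set" where
  "legendrian_isotopy_classes = Collect closed_connected_legendrian // legendrian_isotopy_rel"

definition class_cobordism_rel :: "'n::finite std set set rel" where
  "class_cobordism_rel =
     {(A, B). A \<in> legendrian_isotopy_classes \<and> B \<in> legendrian_isotopy_classes \<and>
        (\<exists>\<Lambda>m\<in>A. \<exists>\<Lambda>p\<in>B. (\<Lambda>m, \<Lambda>p) \<in> cobordism_rel)}"

end

theory Submission
  imports Defs
begin

text \<open>Let \<open>G\<close> be a smooth function on \<open>\<real>\<^sup>n\<close> with regular value \<open>0\<close> and compact \<open>{G \<ge> 0}\<close>. The front
  \<open>z = \<plusminus> G\<^sup>3\<^sup>/\<^sup>2\<close> over \<open>{G \<ge> 0}\<close> has a cusp edge along \<open>{G = 0}\<close> and lifts to a closed Legendrian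
  submanifold \<open>\<Lambda>\<^sub>G\<close>, diffeomorphic to the double \<open>{\<eta>\<^sup>2 = G x}\<close> of \<open>{G \<ge> 0}\<close>. Cobordisms arise in
  the same way one dimension higher. Put \<open>s = e\<^sup>t\<close>; then \<open>e\<^sup>t \<alpha> = s dz - p dx\<close> with \<open>p = s y\<close>, and
  \<open>e\<^sup>t \<alpha> = df\<close> means that \<open>h = s z - f\<close> satisfies \<open>dh = z ds + p dx\<close>: an exact Lagrangian is the
  multivalued gradient of a front \<open>h(s, x)\<close>. It is embedded if no two sheets have the same gradient
  at the same point. For the two sheets \<open>h = \<plusminus> s G(t, x)\<^sup>3\<^sup>/\<^sup>2\<close> this says that \<open>s G\<^sup>3\<^sup>/\<^sup>2\<close> has no critical
  point where \<open>G > 0\<close>, which together with regularity along \<open>{G = 0}\<close> is the condition that \<open>\<partial>\<^sub>x G\<close> and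
  \<open>G + (3/2) \<partial>\<^sub>t G\<close> have no common zero on \<open>{G \<ge> 0}\<close>
  (lemma \<open>exact_lagrangian_cobordism_lift\<close>). It holds in particular while \<open>G\<close> grows strictly with \<open>t\<close>, so a
  domain can be enlarged, whatever handles this attaches (lemma \<open>growing_cobordism\<close>); and it
  allows a ball to shrink, provided that this happens slowly.

  In dimension \<open>n > 1\<close> a round ball contains a shell \<open>S\<^sup>n\<^sup>-\<^sup>1 \<times> [0, 1]\<close>, which contains a small ball.
  Hence there are cobordisms from the Legendrian of the shell to that of the ball, by filling the
  hole, and from that of the ball to that of the shell, by first shrinking the ball until it fits
  into the shell (lemmas \<open>cobordism_shell_ball\<close> and \<open>cobordism_ball_shell\<close>). The doubles are
  \<open>S\<^sup>n\<close> and \<open>S\<^sup>1 \<times> S\<^sup>n\<^sup>-\<^sup>1\<close>; only the first is simply connected, so the two Legendrians are not even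
  homeomorphic (lemma \<open>not_isotopic_ball_shell\<close>). On isotopy classes the same pair violates
  anti-symmetry: each of the two lies in its own class, so equal classes would make them isotopic.\<close>

section \<open>Calculus of smooth maps\<close>

lemma ck_on_cong:
  assumes "open U" "\<And>x. x \<in> U \<Longrightarrow> f x = g x"
  shows "ck_on k U f \<longleftrightarrow> ck_on k U g"
  using assms(2)
proof (induction k arbitrary: f g)
  case 0
  then show ?case by (simp cong: continuous_on_cong)
next
  case (Suc k)
  have D: "(f has_derivative D) (at x) \<longleftrightarrow> (g has_derivative D) (at x)" if "x \<in> U" for x D
    using has_derivative_transform_within_open[OF _ \<open>open U\<close> that, of f D UNIV g]
      has_derivative_transform_within_open[OF _ \<open>open U\<close> that, of g D UNIV f] Suc.prems by auto
  then have "frechet_derivative f (at x) = frechet_derivative g (at x)" if "x \<in> U" for x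
    using that unfolding frechet_derivative_def by simp
  then have "ck_on k U (\<lambda>x. frechet_derivative f (at x) v) \<longleftrightarrow>
      ck_on k U (\<lambda>x. frechet_derivative g (at x) v)" for v
    by (intro Suc.IH) simp
  moreover have "f differentiable_on U \<longleftrightarrow> g differentiable_on U"
    using D \<open>open U\<close> by (simp add: differentiable_on_eq_differentiable_at differentiable_def)
  ultimately show ?case by simp
qed

lemma ck_on_SucD:
  assumes "open U" "ck_on (Suc k) U f" "x \<in> U"
  shows "(f has_derivative frechet_derivative f (at x)) (at x)"
  using assms by (simp add: differentiable_on_eq_differentiable_at frechet_derivative_works)

lemma ck_on_SucI:
  assumes "open U" "\<And>x. x \<in> U \<Longrightarrow> (f has_derivative D x) (at x)"
    and "\<And>v. ck_on k U (\<lambda>x. D x v)"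
  shows "ck_on (Suc k) U f"
proof -
  have "f differentiable_on U"
    using assms by (auto simp: differentiable_on_eq_differentiable_at differentiable_def)
  moreover have "ck_on k U (\<lambda>x. frechet_derivative f (at x) v)" for v
    using ck_on_cong[OF \<open>open U\<close>, of "\<lambda>x. frechet_derivative f (at x) v" "\<lambda>x. D x v"]
      frechet_derivative_at[OF assms(2)] assms(3) by simp
  ultimately show ?thesis by simp
qed

lemma ck_on_Suc_imp:
  assumes "open U" "ck_on (Suc k) U f"
  shows "ck_on k U f"
  using assms(2)
proof (induction k arbitrary: f)
  case 0
  then show ?case by (simp add: differentiable_imp_continuous_on)
next
  case (Suc k)
  show ?case
    using Suc.prems Suc.IH[of "\<lambda>x. frechet_derivative f (at x) _"]
    by (intro ck_on_SucI[OF \<open>open U\<close> ck_on_SucD[OF \<open>open U\<close> Suc.prems]]) auto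
qed

lemma ck_on_subset:
  assumes "open U" "open V" "V \<subseteq> U" "ck_on k U f"
  shows "ck_on k V f"
  using assms(4)
proof (induction k arbitrary: f)
  case 0
  then show ?case using assms(3) continuous_on_subset by auto
next
  case (Suc k)
  then show ?case
    by (metis assms(3) ck_on.simps(2) differentiable_on_subset)
qed

lemma ck_on_const: "open U \<Longrightarrow> ck_on k U (\<lambda>x. c)"
proof (induction k arbitrary: c)
  case (Suc k)
  show ?case by (rule ck_on_SucI[where D = "\<lambda>_ _. 0"]) (use Suc in auto)
qed simp

lemma ck_on_bounded_linear:
  assumes "open U" "bounded_linear f"
  shows "ck_on k U f"
proof (cases k)
  case 0
  then show ?thesis using assms linear_continuous_on by auto
next
  case (Suc k)
  show ?thesis unfolding Suc
    by (rule ck_on_SucI[OF assms(1) bounded_linear_imp_has_derivative[OF assms(2)] ck_on_const[OF assms(1)]])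
qed

lemma ck_on_add:
  assumes "open U" "ck_on k U f" "ck_on k U g"
  shows "ck_on k U (\<lambda>x. f x + g x)"
  using assms(2,3)
proof (induction k arbitrary: f g)
  case 0
  then show ?case by (auto intro: continuous_on_add)
next
  case (Suc k)
  show ?case
    by (rule ck_on_SucI[OF assms(1) has_derivative_add[OF ck_on_SucD ck_on_SucD]])
      (use assms(1) Suc in auto)
qed

lemma ck_on_sum:
  assumes "open U" "finite I" "\<And>i. i \<in> I \<Longrightarrow> ck_on k U (f i)"
  shows "ck_on k U (\<lambda>x. \<Sum>i\<in>I. f i x)"
  using assms(2,3) by (induction I rule: finite_induct) (auto intro: ck_on_const ck_on_add assms(1))

lemma ck_on_bilinear:
  assumes "bounded_bilinear B" "open U" "ck_on k U f" "ck_on k U g"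
  shows "ck_on k U (\<lambda>x. B (f x) (g x))"
  using assms(3,4)
proof (induction k arbitrary: f g)
  case 0
  then show ?case by (auto intro: bounded_bilinear.continuous_on[OF assms(1)])
next
  case (Suc k)
  have "ck_on k U f" "ck_on k U g"
    using Suc.prems ck_on_Suc_imp[OF assms(2)] by blast+
  then show ?case
    using Suc
    by (intro ck_on_SucI[OF assms(2) bounded_bilinear.FDERIV[OF assms(1) ck_on_SucD ck_on_SucD]]
         ck_on_add assms(2) Suc.IH) (use assms(2) in auto)
qed

text \<open>The chain rule evaluates the derivative of \<open>g\<close> in a direction that varies with the point;
  expanding that direction in a basis turns it into a sum of products of maps of the same class.\<close>

lemma ck_on_compose:
  assumes "open U" "open V" "f ` U \<subseteq> V" "ck_on k U f" "ck_on k V g"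
  shows "ck_on k U (\<lambda>x. g (f x))"
  using assms(3-5)
proof (induction k arbitrary: f g)
  case 0
  then show ?case using continuous_on_compose2 by auto
next
  case (Suc k)
  let ?D = "\<lambda>x v. \<Sum>b\<in>Basis. (frechet_derivative f (at x) v \<bullet> b) *\<^sub>R frechet_derivative g (at (f x)) b"
  show ?case
  proof (rule ck_on_SucI[OF assms(1)])
    fix x assume x: "x \<in> U"
    have g: "(g has_derivative frechet_derivative g (at (f x))) (at (f x))"
      using ck_on_SucD[OF assms(2) Suc.prems(3)] x Suc.prems(1) by auto
    have expand: "frechet_derivative g (at (f x)) v =
        (\<Sum>b\<in>Basis. (v \<bullet> b) *\<^sub>R frechet_derivative g (at (f x)) b)" for v
    proof -
      have lin: "linear (frechet_derivative g (at (f x)))"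
        using has_derivative_linear[OF g] .
      have "frechet_derivative g (at (f x)) v =
          frechet_derivative g (at (f x)) (\<Sum>b\<in>Basis. (v \<bullet> b) *\<^sub>R b)"
        by (simp only: euclidean_representation)
      then show ?thesis by (simp only: linear_sum[OF lin] linear_cmul[OF lin])
    qed
    have "(\<lambda>v. frechet_derivative g (at (f x)) (frechet_derivative f (at x) v)) = ?D x"
      by (rule ext, rule expand)
    with has_derivative_compose[OF ck_on_SucD[OF assms(1) Suc.prems(2) x] g]
    show "((\<lambda>x. g (f x)) has_derivative ?D x) (at x)"
      by (simp only:)
  next
    fix v
    have "ck_on k U f" using Suc.prems ck_on_Suc_imp[OF assms(1)] by blast
    then have "ck_on k U (\<lambda>x. frechet_derivative g (at (f x)) b)" for b
      using Suc.prems by (intro Suc.IH[where g = "\<lambda>y. frechet_derivative g (at y) b"]) auto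
    then show "ck_on k U (\<lambda>x. ?D x v)"
      using Suc.prems
      by (intro ck_on_sum ck_on_bilinear[OF bounded_bilinear_scaleR]
          ck_on_bilinear[OF bounded_bilinear_inner] ck_on_const assms(1)) auto
  qed
qed

lemma smooth_on_open_open: "smooth_on_open U f \<Longrightarrow> open U"
  by (simp add: smooth_on_open_def)

lemma smooth_on_open_continuous: "smooth_on_open U f \<Longrightarrow> continuous_on U f"
  unfolding smooth_on_open_def using ck_on.simps(1) by blast

lemma smooth_on_open_subset:
  "smooth_on_open U f \<Longrightarrow> open V \<Longrightarrow> V \<subseteq> U \<Longrightarrow> smooth_on_open V f"
  unfolding smooth_on_open_def using ck_on_subset by blast

lemma smooth_on_open_has_derivative:
  assumes "smooth_on_open U f" "x \<in> U"
  shows "(f has_derivative frechet_derivative f (at x)) (at x)"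
  using assms ck_on_SucD unfolding smooth_on_open_def by blast

lemma smooth_on_open_const: "open U \<Longrightarrow> smooth_on_open U (\<lambda>x. c)"
  by (simp add: smooth_on_open_def ck_on_const)

lemma smooth_on_open_linear: "open U \<Longrightarrow> bounded_linear f \<Longrightarrow> smooth_on_open U f"
  by (simp add: smooth_on_open_def ck_on_bounded_linear)

lemma smooth_on_open_ident: "open U \<Longrightarrow> smooth_on_open U (\<lambda>x. x)"
  by (simp add: smooth_on_open_linear bounded_linear_ident)

lemma smooth_on_open_add:
  "smooth_on_open U f \<Longrightarrow> smooth_on_open U g \<Longrightarrow> smooth_on_open U (\<lambda>x. f x + g x)"
  by (simp add: smooth_on_open_def ck_on_add)

lemma smooth_on_open_bilinear:
  "bounded_bilinear B \<Longrightarrow> smooth_on_open U f \<Longrightarrow> smooth_on_open U g \<Longrightarrow>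
    smooth_on_open U (\<lambda>x. B (f x) (g x))"
  by (simp add: smooth_on_open_def ck_on_bilinear)

lemmas smooth_on_open_mult = smooth_on_open_bilinear[OF bounded_bilinear_mult]
lemmas smooth_on_open_scaleR = smooth_on_open_bilinear[OF bounded_bilinear_scaleR]
lemmas smooth_on_open_inner = smooth_on_open_bilinear[OF bounded_bilinear_inner]

lemma smooth_on_open_compose:
  "smooth_on_open V g \<Longrightarrow> smooth_on_open U f \<Longrightarrow> f ` U \<subseteq> V \<Longrightarrow> smooth_on_open U (\<lambda>x. g (f x))"
  unfolding smooth_on_open_def using ck_on_compose by blast

lemma smooth_on_open_bounded_linear:
  "bounded_linear h \<Longrightarrow> smooth_on_open U f \<Longrightarrow> smooth_on_open U (\<lambda>x. h (f x))"
  using smooth_on_open_compose[OF smooth_on_open_linear[OF open_UNIV], of h U f] by simp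

lemma smooth_on_open_compose_linear:
  "smooth_on_open UNIV g \<Longrightarrow> bounded_linear h \<Longrightarrow> open U \<Longrightarrow> smooth_on_open U (\<lambda>x. g (h x))"
  using smooth_on_open_compose[OF _ smooth_on_open_linear, of UNIV g U h] by simp

lemma smooth_on_open_minus: "smooth_on_open U f \<Longrightarrow> smooth_on_open U (\<lambda>x. - f x)"
  by (rule smooth_on_open_bounded_linear[OF bounded_linear_minus[OF bounded_linear_ident]])

lemma smooth_on_open_diff:
  "smooth_on_open U f \<Longrightarrow> smooth_on_open U g \<Longrightarrow> smooth_on_open U (\<lambda>x. f x - g x)"
  using smooth_on_open_add[OF _ smooth_on_open_minus] by fastforce

lemma smooth_on_open_fst: "smooth_on_open U f \<Longrightarrow> smooth_on_open U (\<lambda>x. fst (f x))"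
  by (rule smooth_on_open_bounded_linear[OF bounded_linear_fst])

lemma smooth_on_open_snd: "smooth_on_open U f \<Longrightarrow> smooth_on_open U (\<lambda>x. snd (f x))"
  by (rule smooth_on_open_bounded_linear[OF bounded_linear_snd])

lemma smooth_on_open_Pair:
  assumes "smooth_on_open U f" "smooth_on_open U g"
  shows "smooth_on_open U (\<lambda>x. (f x, g x))"
  using smooth_on_open_add[OF smooth_on_open_bounded_linear[of "\<lambda>a. (a, 0)", OF _ assms(1)]
      smooth_on_open_bounded_linear[of "\<lambda>b. (0, b)", OF _ assms(2)]]
  by (simp add: bounded_linear_Pair bounded_linear_ident bounded_linear_zero)

lemma smooth_on_open_power:
  fixes f :: "'a::euclidean_space \<Rightarrow> real"
  shows "smooth_on_open U f \<Longrightarrow> smooth_on_open U (\<lambda>x. f x ^ m)"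
  by (induction m) (auto intro: smooth_on_open_mult smooth_on_open_const smooth_on_open_open)

lemma smooth_on_open_exp: "smooth_on_open U (exp :: real \<Rightarrow> real)" if "open U"
  unfolding smooth_on_open_def
proof (intro conjI allI)
  fix k show "ck_on k U (exp :: real \<Rightarrow> real)"
  proof (induction k)
    case 0 then show ?case by (simp add: continuous_on_exp)
  next
    case (Suc k)
    show ?case
      by (rule ck_on_SucI[OF that has_derivative_exp[OF has_derivative_ident]])
        (intro ck_on_bilinear[OF bounded_bilinear_mult] ck_on_const that Suc)
  qed
qed (fact that)

lemma smooth_on_open_inverse: "smooth_on_open (- {0}) (inverse :: real \<Rightarrow> real)"
  unfolding smooth_on_open_def
proof (intro conjI allI)
  fix k show "ck_on k (- {0}) (inverse :: real \<Rightarrow> real)"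
  proof (induction k)
    case 0 then show ?case by (auto intro: continuous_on_inverse continuous_on_id)
  next
    case (Suc k)
    have D: "((\<lambda>x. inverse x) has_derivative (\<lambda>v. (inverse x * inverse x) * (- v))) (at x)"
      if "x \<in> - {0}" for x :: real
      using that by (auto intro!: derivative_eq_intros)
    show ?case
    proof (rule ck_on_SucI[OF _ D])
      show "ck_on k (- {0}) (\<lambda>x. (inverse x * inverse x) * (- v))" for v :: real
        by (intro ck_on_bilinear[OF bounded_bilinear_mult] ck_on_const Suc) auto
    qed auto
  qed
qed auto

lemma smooth_on_open_divide:
  fixes f g :: "'a::euclidean_space \<Rightarrow> real"
  assumes "smooth_on_open U f" "smooth_on_open U g" "\<And>x. x \<in> U \<Longrightarrow> g x \<noteq> 0"
  shows "smooth_on_open U (\<lambda>x. f x / g x)"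
  unfolding divide_inverse
  by (intro smooth_on_open_mult assms smooth_on_open_compose[OF smooth_on_open_inverse])
    (use assms in auto)

lemmas smooth_intros =
  smooth_on_open_const smooth_on_open_ident smooth_on_open_add smooth_on_open_diff
  smooth_on_open_minus smooth_on_open_mult smooth_on_open_scaleR smooth_on_open_inner
  smooth_on_open_fst smooth_on_open_snd smooth_on_open_Pair smooth_on_open_power
  smooth_on_open_divide

text \<open>Bootstrapping: a differentiable \<open>g\<close> whose derivative at \<open>y\<close> depends smoothly on the value
  \<open>g y\<close> gains one derivative from each class it is already known to lie in. The inverse of a
  smooth map has this form, its derivative being the inverse of the derivative at \<open>g y\<close>.\<close>

lemma smooth_on_open_bootstrap:
  assumes "open V" "g ` V \<subseteq> U"
    and "\<And>y. y \<in> V \<Longrightarrow> (g has_derivative (\<lambda>v. R v (g y))) (at y)"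
    and "\<And>v. smooth_on_open U (R v)"
  shows "smooth_on_open V g"
  unfolding smooth_on_open_def
proof (intro conjI allI)
  fix k show "ck_on k V g"
  proof (induction k)
    case 0
    show ?case
      using assms(1) has_derivative_continuous[OF assms(3)]
      by (simp add: continuous_on_eq_continuous_at)
  next
    case (Suc k)
    show ?case
      by (rule ck_on_SucI[OF assms(1,3)], assumption, rule ck_on_compose[OF assms(1) _ assms(2) Suc])
        (use assms(4) in \<open>auto simp: smooth_on_open_def\<close>)
  qed
qed (fact assms(1))

lemma smooth_on_open_imp_map_on:
  "smooth_on_open U f \<Longrightarrow> S \<subseteq> U \<Longrightarrow> smooth_map_on S f"
  unfolding smooth_map_on_def by blast

lemma smooth_map_on_compose:
  assumes "smooth_map_on S f" "smooth_map_on T g" "f ` S \<subseteq> T"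
  shows "smooth_map_on S (g \<circ> f)"
  unfolding smooth_map_on_def
proof
  fix p assume p: "p \<in> S"
  obtain U f' where f': "p \<in> U" "smooth_on_open U f'" "\<forall>x\<in>S \<inter> U. f' x = f x"
    using assms(1) p unfolding smooth_map_on_def by blast
  obtain W g' where g': "f p \<in> W" "smooth_on_open W g'" "\<forall>x\<in>T \<inter> W. g' x = g x"
    using assms(2,3) p unfolding smooth_map_on_def by blast
  let ?U = "U \<inter> f' -` W"
  have "open ?U"
    by (rule continuous_open_preimage[OF smooth_on_open_continuous[OF f'(2)]
          smooth_on_open_open[OF f'(2)] smooth_on_open_open[OF g'(2)]])
  then have "smooth_on_open ?U (\<lambda>x. g' (f' x))"
    by (intro smooth_on_open_compose[OF g'(2)] smooth_on_open_subset[OF f'(2)]) auto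
  moreover have "p \<in> ?U" "\<forall>x\<in>S \<inter> ?U. g' (f' x) = (g \<circ> f) x"
    using f' g' p assms(3) by auto
  ultimately show "\<exists>U h. p \<in> U \<and> smooth_on_open U h \<and> (\<forall>x\<in>S \<inter> U. h x = (g \<circ> f) x)"
    by (intro exI[of _ ?U] exI[of _ "\<lambda>x. g' (f' x)"] conjI)
qed

lemma diffeomorphism_betweenI:
  assumes "smooth_on_open U f" "smooth_on_open V g" "f ` U \<subseteq> V" "g ` V \<subseteq> U"
    and "\<And>x. x \<in> U \<Longrightarrow> g (f x) = x" "\<And>y. y \<in> V \<Longrightarrow> f (g y) = y"
  shows "diffeomorphism_between U V f"
  unfolding diffeomorphism_between_def
  by (rule exI[of _ g], intro conjI homeomorphismI smooth_on_open_imp_map_on[OF assms(1)]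
      smooth_on_open_imp_map_on[OF assms(2)] smooth_on_open_continuous[OF assms(1)]
      smooth_on_open_continuous[OF assms(2)]) (use assms in auto)

lemma diffeomorphism_between_compose:
  assumes "diffeomorphism_between S T f" "diffeomorphism_between T W g"
  shows "diffeomorphism_between S W (g \<circ> f)"
proof -
  obtain f' where f': "homeomorphism S T f f'" "smooth_map_on S f" "smooth_map_on T f'"
    using assms(1) unfolding diffeomorphism_between_def by blast
  obtain g' where g': "homeomorphism T W g g'" "smooth_map_on T g" "smooth_map_on W g'"
    using assms(2) unfolding diffeomorphism_between_def by blast
  have "homeomorphism S W (g \<circ> f) (f' \<circ> g')"
    using homeomorphism_compose f'(1) g'(1) by blast
  moreover have "smooth_map_on S (g \<circ> f)" "smooth_map_on W (f' \<circ> g')"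
    using f' g' by (auto intro!: smooth_map_on_compose simp: homeomorphism_def)
  ultimately show ?thesis unfolding diffeomorphism_between_def by blast
qed

section \<open>Two-sheeted graphs as submanifolds\<close>

lemma submanifold_linear_image:
  assumes A: "bounded_linear A" and B: "bounded_linear B"
    and inv: "\<And>x. B (A x) = x" "\<And>y. A (B y) = y" and M: "submanifold k M"
  shows "submanifold k (A ` M)"
  unfolding submanifold_def
proof
  fix p assume "p \<in> A ` M"
  then obtain q where q: "q \<in> M" "p = A q" by blast
  obtain U V and P :: "'a set" and \<phi> where c: "q \<in> U" "open U" "open V" "diffeomorphism_between U V \<phi>"
      "subspace P" "dim P = k" "\<phi> ` (M \<inter> U) = P \<inter> V"
    using M[unfolded submanifold_def, rule_format, OF q(1)] by (elim exE conjE) (rule that; assumption)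
  have image_A: "A ` X = B -` X" for X
    using image_eqI[of _ A "B _" X] by (auto simp: inv)
  have op: "open (A ` X)" if "open X" for X
    unfolding image_A using that linear_continuous_on[OF B, of UNIV] by (simp add: open_vimage)
  have diff: "diffeomorphism_between X (A ` X) A" "diffeomorphism_between (A ` X) X B" if "open X" for X
    by (rule diffeomorphism_betweenI[where g = B],
        use that op smooth_on_open_linear A B inv in \<open>auto\<close>)
      (rule diffeomorphism_betweenI[where g = A],
        use that op smooth_on_open_linear A B inv in \<open>auto\<close>)
  have "diffeomorphism_between (A ` U) (A ` V) (A \<circ> (\<phi> \<circ> B))"
    using diffeomorphism_between_compose[OF diffeomorphism_between_compose[OF diff(2) c(4)] diff(1)]
      c(2,3) by blast
  moreover have "dim (A ` P) = k"
    using dim_image_eq[of A P] inv(1) c(6) bounded_linear.linear[OF A] by (metis inj_on_inverseI inj_onI)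
  moreover have "(A \<circ> (\<phi> \<circ> B)) ` (A ` M \<inter> A ` U) = A ` P \<inter> A ` V"
  proof -
    have i: "inj A" using inv(1) by (metis injI)
    have "(A \<circ> (\<phi> \<circ> B)) ` (A ` M \<inter> A ` U) = A ` (\<phi> ` (M \<inter> U))"
      by (simp add: image_Int[OF i, symmetric] image_comp comp_def inv)
    then show ?thesis by (simp add: c(7) image_Int[OF i])
  qed
  ultimately show "\<exists>U V (P :: 'b set) \<phi>. p \<in> U \<and> open U \<and> open V \<and>
      diffeomorphism_between U V \<phi> \<and> subspace P \<and> dim P = k \<and> \<phi> ` (A ` M \<inter> U) = P \<inter> V"
    using q c op linear_subspace_image[OF bounded_linear.linear[OF A]]
    by (intro exI[of _ "A ` U"] exI[of _ "A ` V"] exI[of _ "A ` P"] exI[of _ "A \<circ> (\<phi> \<circ> B)"] conjI) auto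
qed

text \<open>The component in the direction \<open>d\<close> of the gradient is replaced by \<open>F\<close> itself, so the level
  set \<open>F = 0\<close> becomes a piece of the hyperplane orthogonal to \<open>d\<close>. Since only one coordinate
  changes, the inverse of the derivative is an explicit rational expression in the gradient, and
  the bootstrapping lemma applies to the inverse map.\<close>

lemma hypersurface_chart:
  fixes F :: "'a::euclidean_space \<Rightarrow> real"
  assumes F: "smooth_on_open W F" and N: "smooth_on_open W N"
    and der: "\<And>x. x \<in> W \<Longrightarrow> (F has_derivative (\<lambda>v. N x \<bullet> v)) (at x)"
    and p: "p \<in> W" "N p \<noteq> 0"
  defines "d \<equiv> N p /\<^sub>R norm (N p)"
  defines "\<phi> \<equiv> \<lambda>x. x + (F x - d \<bullet> x) *\<^sub>R d"
  obtains U V g where "open U" "U \<subseteq> W" "p \<in> U" "smooth_on_open U \<phi>" "smooth_on_open V g"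
    "\<phi> ` U \<subseteq> V" "g ` V \<subseteq> U" "\<And>x. x \<in> U \<Longrightarrow> g (\<phi> x) = x" "\<And>y. y \<in> V \<Longrightarrow> \<phi> (g y) = y"
proof -
  have dd: "d \<bullet> d = 1" and Npd: "N p \<bullet> d > 0"
    using p(2) by (auto simp: d_def dot_square_norm power2_eq_square)
  define W' where "W' = W \<inter> (\<lambda>x. N x \<bullet> d) -` {0<..}"
  have W': "W' \<subseteq> W" "p \<in> W'" using Npd p(1) by (auto simp: W'_def)
  have openW': "open W'"
    unfolding W'_def
    by (rule continuous_open_preimage)
      (auto intro!: continuous_intros smooth_on_open_continuous[OF N] smooth_on_open_open[OF N])
  define \<phi>' where
    "\<phi>' x = id_blinfun + (blinfun_scaleR_left d o\<^sub>L blinfun_inner_left (N x - d))" for x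
  have \<phi>'_apply: "blinfun_apply (\<phi>' x) v = v + ((N x - d) \<bullet> v) *\<^sub>R d" for x v
    by (simp add: \<phi>'_def blinfun.bilinear_simps inner_commute)
  define R where "R v x = v + ((d - N x) \<bullet> v / (N x \<bullet> d)) *\<^sub>R d" for v x
  have R_left: "R (blinfun_apply (\<phi>' x) v) x = v" and R_right: "blinfun_apply (\<phi>' x) (R v x) = v"
    if "N x \<bullet> d \<noteq> 0" for x v
  proof -
    have e: "v + s *\<^sub>R d + t *\<^sub>R d = v \<longleftrightarrow> s + t = 0" for s t
    proof -
      have "d \<noteq> 0" using dd by auto
      moreover have "v + s *\<^sub>R d + t *\<^sub>R d = v + (s + t) *\<^sub>R d"
        by (simp add: scaleR_left_distrib)
      ultimately show ?thesis by simp
    qed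
    show "R (blinfun_apply (\<phi>' x) v) x = v" "blinfun_apply (\<phi>' x) (R v x) = v"
      unfolding \<phi>'_apply R_def e using that dd
      by (simp_all add: inner_diff inner_add algebra_simps field_simps)
  qed
  have "(\<phi> has_derivative blinfun_apply (\<phi>' x)) (at x)" if "x \<in> W'" for x
    unfolding \<phi>_def using that W'(1)
    by (auto intro!: derivative_eq_intros der simp: \<phi>'_apply fun_eq_iff inner_diff_left)
  moreover have "continuous_on W' \<phi>'"
    unfolding \<phi>'_def
    by (intro continuous_intros bounded_linear.continuous_on[OF bounded_linear_blinfun_inner_left]
        continuous_on_subset[OF smooth_on_open_continuous[OF N] W'(1)])
  moreover have "(id_blinfun + (blinfun_scaleR_left d o\<^sub>L
      blinfun_inner_left ((d - N p) /\<^sub>R (N p \<bullet> d)))) o\<^sub>L \<phi>' p = id_blinfun"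
  proof (rule blinfun_eqI)
    fix v
    have "blinfun_apply (id_blinfun + (blinfun_scaleR_left d o\<^sub>L
      blinfun_inner_left ((d - N p) /\<^sub>R (N p \<bullet> d)))) u = R u p" for u
      by (simp add: R_def blinfun.bilinear_simps inner_commute divide_inverse mult.commute)
    then show "blinfun_apply ((id_blinfun + (blinfun_scaleR_left d o\<^sub>L
      blinfun_inner_left ((d - N p) /\<^sub>R (N p \<bullet> d)))) o\<^sub>L \<phi>' p) v = blinfun_apply id_blinfun v"
      using R_left[of p v] Npd by simp
  qed
  ultimately obtain U V g g' where UV: "open U" "U \<subseteq> W'" "p \<in> U" "open V" "\<phi> p \<in> V"
      "homeomorphism U V \<phi> g" "\<And>y. y \<in> V \<Longrightarrow> (g has_derivative (g' y)) (at y)"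
      "\<And>y. y \<in> V \<Longrightarrow> g' y = inv (blinfun_apply (\<phi>' (g y)))"
    using inverse_function_theorem[OF openW' _ _ W'(2), of \<phi> \<phi>'] by metis
  have gV: "g ` V \<subseteq> W'" using UV(2,6) by (auto simp: homeomorphism_def)
  have "g' y = (\<lambda>v. R v (g y))" if "y \<in> V" for y
  proof -
    have "N (g y) \<bullet> d \<noteq> 0" using gV that by (auto simp: W'_def)
    then show ?thesis
      unfolding UV(8)[OF that] by (intro inv_equality) (simp_all add: R_left R_right)
  qed
  moreover have "smooth_on_open W' (R v)" for v
    unfolding R_def
    by (intro smooth_intros smooth_on_open_subset[OF N openW' W'(1)] openW') (auto simp: W'_def)
  ultimately have "smooth_on_open V g"
    using UV(7) by (intro smooth_on_open_bootstrap[OF UV(4) gV, of R]) auto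
  moreover have "smooth_on_open U \<phi>"
    unfolding \<phi>_def using UV(1,2) W'(1)
    by (intro smooth_intros smooth_on_open_subset[OF F]) auto
  ultimately show ?thesis
    using UV(1,2,3,6) W'(1) by (intro that[of U V g]) (auto simp: homeomorphism_def)
qed

text \<open>The two sheets \<open>v = \<plusminus> \<surd>(G q) w q\<close> over \<open>{G \<ge> 0}\<close>, glued along \<open>{G = 0}\<close>. The parameter \<open>\<eta>\<close>, a
  square root of \<open>G\<close>, extends smoothly across the fold, unlike either branch of the root.\<close>

definition two_sheets ::
  "('a::euclidean_space \<Rightarrow> real) \<Rightarrow> ('a \<Rightarrow> 'b::euclidean_space) \<Rightarrow> ('a \<times> 'b) set" where
  "two_sheets G w = {(q, v). \<exists>\<eta>. \<eta>\<^sup>2 = G q \<and> v = \<eta> *\<^sub>R w q}"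

text \<open>Near a point over \<open>q\<^sub>0\<close> the parameter \<open>\<eta>\<close> is the ratio of the components of \<open>v\<close> and \<open>w q\<close>
  along \<open>a = w q\<^sub>0\<close>. Shearing \<open>w q\<close> onto the constant vector \<open>a\<close> turns the set into the
  hypersurface \<open>\<eta>\<^sup>2 = G q\<close> inside the linear space of pairs \<open>(q, \<eta> a)\<close>, whose equation has non-zero
  gradient; the hypersurface chart respects that linear space because the gradient lies in it.\<close>

lemma submanifold_two_sheets:
  fixes G :: "'a::euclidean_space \<Rightarrow> real" and w :: "'a \<Rightarrow> 'b::euclidean_space"
  assumes G: "smooth_on_open UNIV G" and dG: "smooth_on_open UNIV dG"
    and der: "\<And>q. (G has_derivative (\<lambda>v. dG q \<bullet> v)) (at q)"
    and reg: "\<And>q. G q = 0 \<Longrightarrow> dG q \<noteq> 0"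
    and w: "smooth_on_open UNIV w" and w0: "\<And>q. G q \<ge> 0 \<Longrightarrow> w q \<noteq> 0"
  shows "submanifold DIM('a) (two_sheets G w)"
  unfolding submanifold_def
proof
  fix p assume "p \<in> two_sheets G w"
  then obtain q0 \<eta>0 where p: "p = (q0, \<eta>0 *\<^sub>R w q0)" "\<eta>0\<^sup>2 = G q0"
    unfolding two_sheets_def by blast
  define a where "a = w q0"
  have a: "a \<noteq> 0" using w0[of q0] p(2) by (metis a_def zero_le_power2)
  then have aa: "a \<bullet> a > 0" by simp
  define U1 where "U1 = {x :: 'a \<times> 'b. w (fst x) \<bullet> a > 0}"
  define h where "h = (\<lambda>x :: 'a \<times> 'b. (snd x \<bullet> a) / (w (fst x) \<bullet> a))"
  define \<phi>1 where "\<phi>1 = (\<lambda>x :: 'a \<times> 'b. (fst x, snd x + h x *\<^sub>R (a - w (fst x))))"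
  define \<psi>1 where
    "\<psi>1 = (\<lambda>x :: 'a \<times> 'b. (fst x, snd x + ((snd x \<bullet> a) / (a \<bullet> a)) *\<^sub>R (w (fst x) - a)))"
  have sw: "smooth_on_open U (\<lambda>x. w (fst x))" if "open U" for U :: "('a \<times> 'b) set"
    by (rule smooth_on_open_compose[OF w]) (auto intro: smooth_on_open_linear that bounded_linear_fst)
  have openU1: "open U1"
    unfolding U1_def using smooth_on_open_continuous[OF sw[OF open_UNIV]]
    by (auto intro!: open_Collect_less continuous_intros)
  have s1: "smooth_on_open U1 \<phi>1"
    unfolding \<phi>1_def h_def by (intro smooth_intros sw openU1) (auto simp: U1_def)
  have t1: "smooth_on_open UNIV \<psi>1"
    unfolding \<psi>1_def by (intro smooth_intros sw) (use a in auto)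
  have \<phi>1a: "snd (\<phi>1 x) \<bullet> a = h x * (a \<bullet> a)" if "x \<in> U1" for x
    using that by (simp add: \<phi>1_def h_def U1_def inner_add inner_diff field_simps)
  have \<psi>1\<phi>1: "\<psi>1 (\<phi>1 x) = x" if "x \<in> U1" for x
    using \<phi>1a[OF that] a by (simp add: \<psi>1_def prod_eq_iff) (simp add: \<phi>1_def algebra_simps)
  have h\<psi>1: "h (\<psi>1 x) = (snd x \<bullet> a) / (a \<bullet> a)" if "x \<in> U1" for x
    using that a by (simp add: \<psi>1_def h_def U1_def inner_add inner_diff field_simps)
  have \<phi>1\<psi>1: "\<phi>1 (\<psi>1 x) = x" if "x \<in> U1" for x
    using h\<psi>1[OF that] by (simp add: \<phi>1_def prod_eq_iff) (simp add: \<psi>1_def algebra_simps)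
  have fst1: "fst (\<phi>1 x) = fst x" "fst (\<psi>1 x) = fst x" for x
    by (simp_all add: \<phi>1_def \<psi>1_def)
  have U1_iff: "\<phi>1 x \<in> U1 \<longleftrightarrow> x \<in> U1" "\<psi>1 x \<in> U1 \<longleftrightarrow> x \<in> U1" for x
    by (simp_all add: U1_def fst1)
  define N where "N = {x :: 'a \<times> 'b. snd x \<in> span {a} \<and> (snd x \<bullet> a)\<^sup>2 / (a \<bullet> a)\<^sup>2 - G (fst x) = 0}"
  have N_iff: "\<phi>1 x \<in> N \<longleftrightarrow> x \<in> two_sheets G w" if x: "x \<in> U1" for x
  proof
    assume "\<phi>1 x \<in> N"
    then obtain c where c: "snd (\<phi>1 x) = c *\<^sub>R a" and g: "(snd (\<phi>1 x) \<bullet> a)\<^sup>2 / (a \<bullet> a)\<^sup>2 = G (fst x)"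
      by (auto simp: N_def span_singleton fst1 a)
    have "c = h x" using \<phi>1a[OF x] c a by simp
    with c have "snd x = h x *\<^sub>R w (fst x)" by (simp add: \<phi>1_def algebra_simps)
    moreover have "(h x)\<^sup>2 = G (fst x)"
      using g a by (simp add: \<phi>1a[OF x] power_mult_distrib)
    ultimately show "x \<in> two_sheets G w" by (auto simp: two_sheets_def case_prod_beta)
  next
    assume "x \<in> two_sheets G w"
    then obtain \<eta> where e: "\<eta>\<^sup>2 = G (fst x)" "snd x = \<eta> *\<^sub>R w (fst x)"
      by (auto simp: two_sheets_def case_prod_beta)
    have "h x = \<eta>" using x by (simp add: h_def e U1_def)
    then have "snd (\<phi>1 x) = \<eta> *\<^sub>R a" by (simp add: \<phi>1_def e algebra_simps)
    then show "\<phi>1 x \<in> N"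
      using e(1) a by (auto simp: N_def fst1 span_singleton power_mult_distrib)
  qed
  define F where "F = (\<lambda>x :: 'a \<times> 'b. (snd x \<bullet> a)\<^sup>2 / (a \<bullet> a)\<^sup>2 - G (fst x))"
  define dF where
    "dF = (\<lambda>x :: 'a \<times> 'b. (- dG (fst x), (2 * (snd x \<bullet> a) / (a \<bullet> a)\<^sup>2) *\<^sub>R a))"
  have sF: "smooth_on_open U1 F"
    unfolding F_def
    by (intro smooth_intros smooth_on_open_compose[OF G] openU1) (use a in auto)
  have sdF: "smooth_on_open U1 dF"
    unfolding dF_def
    by (intro smooth_intros smooth_on_open_compose[OF dG] openU1) (use a in auto)
  have dF: "(F has_derivative (\<lambda>v. dF x \<bullet> v)) (at x)" for x
  proof -
    have "((\<lambda>x. G (fst x)) has_derivative (\<lambda>v. dG (fst x) \<bullet> fst v)) (at x)"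
      by (rule has_derivative_compose[OF has_derivative_fst[OF has_derivative_ident] der])
    then have "(F has_derivative (\<lambda>v. 2 * (snd x \<bullet> a) * (snd v \<bullet> a) / (a \<bullet> a)\<^sup>2 - dG (fst x) \<bullet> fst v)) (at x)"
      unfolding F_def by (auto intro!: derivative_eq_intros simp: a fun_eq_iff power2_eq_square power4_eq_xxxx)
    then show ?thesis
      by (rule has_derivative_eq_rhs) (simp add: dF_def fun_eq_iff inner_Pair_0 inner_prod_def inner_commute)
  qed
  define x0 where "x0 = \<phi>1 p"
  have pU1: "p \<in> U1" using aa by (simp add: U1_def p a_def)
  have x0: "x0 \<in> U1" "fst x0 = q0" "snd x0 = \<eta>0 *\<^sub>R a"
    using pU1 a by (simp_all add: x0_def U1_iff) (simp_all add: \<phi>1_def p a_def)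
  have dF0: "dF x0 \<noteq> 0"
    using reg[of q0] p(2) a x0 by (auto simp: dF_def zero_prod_def)
  define d where "d = dF x0 /\<^sub>R norm (dF x0)"
  define \<phi>2 where "\<phi>2 = (\<lambda>x. x + (F x - d \<bullet> x) *\<^sub>R d)"
  obtain U2 V2 \<psi>2 where c2: "open U2" "U2 \<subseteq> U1" "x0 \<in> U2" "smooth_on_open U2 \<phi>2"
      "smooth_on_open V2 \<psi>2" "\<phi>2 ` U2 \<subseteq> V2" "\<psi>2 ` V2 \<subseteq> U2"
      "\<And>x. x \<in> U2 \<Longrightarrow> \<psi>2 (\<phi>2 x) = x" "\<And>y. y \<in> V2 \<Longrightarrow> \<phi>2 (\<psi>2 y) = y"
    using hypersurface_chart[OF sF sdF dF x0(1) dF0] unfolding \<phi>2_def d_def by blast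
  have dd: "d \<bullet> d = 1"
    using dF0 by (auto simp: d_def dot_square_norm power2_eq_square)
  have dS: "snd d \<in> span {a}"
    by (auto simp: d_def dF_def span_singleton)
  define S where "S = (UNIV :: 'a set) \<times> span {a}"
  have S: "subspace S" unfolding S_def by (intro subspace_Times subspace_UNIV subspace_span)
  have dS': "d \<in> S" using dS by (cases d) (simp add: S_def)
  define P where "P = {x \<in> S. \<forall>y\<in>span {d}. orthogonal y x}"
  have P_iff: "x \<in> P \<longleftrightarrow> x \<in> S \<and> d \<bullet> x = 0" for x
    by (auto simp: P_def orthogonal_def span_singleton)
  have subP: "subspace P"
    using S by (auto simp: subspace_def P_iff inner_add)
  have "dim P + dim (span {d}) = dim S"
    unfolding P_def using dS' S by (intro dim_subspace_orthogonal_to_vectors) (use span_minimal[of "{d}" S] dS' S in auto)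
  moreover have "dim (span {d}) = 1" using dd by (auto simp: dim_singleton)
  moreover have "dim S = DIM('a) + 1"
    unfolding S_def using a by (subst dim_Times) (auto simp: dim_singleton)
  ultimately have dimP: "dim P = DIM('a)" by simp
  have \<phi>2S: "\<phi>2 x \<in> S \<longleftrightarrow> x \<in> S" for x
  proof -
    have "x = \<phi>2 x - (F x - d \<bullet> x) *\<^sub>R d" by (simp add: \<phi>2_def)
    then show ?thesis
      using S dS' by (metis \<phi>2_def subspace_add subspace_diff subspace_scale)
  qed
  have P\<phi>2: "\<phi>2 x \<in> P \<longleftrightarrow> x \<in> N" for x
  proof -
    have "d \<bullet> \<phi>2 x = F x" using dd by (simp add: \<phi>2_def inner_add)
    moreover have "x \<in> S \<longleftrightarrow> snd x \<in> span {a}" by (cases x) (simp add: S_def)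
    ultimately show ?thesis by (simp add: P_iff \<phi>2S N_def F_def)
  qed
  define U where "U = U1 \<inter> \<phi>1 -` U2"
  have openU: "open U" unfolding U_def
    by (rule continuous_open_preimage[OF smooth_on_open_continuous[OF s1] openU1 c2(1)])
  have m: "\<psi>2 y \<in> U2" "\<psi>2 y \<in> U1" if "y \<in> V2" for y
    using c2(2,7) that by auto
  have "diffeomorphism_between U V2 (\<phi>2 \<circ> \<phi>1)"
    unfolding comp_def
  proof (rule diffeomorphism_betweenI[where g = "\<lambda>y. \<psi>1 (\<psi>2 y)"])
    show "smooth_on_open U (\<lambda>x. \<phi>2 (\<phi>1 x))"
      by (rule smooth_on_open_compose[OF c2(4) smooth_on_open_subset[OF s1 openU]]) (auto simp: U_def)
    show "smooth_on_open V2 (\<lambda>y. \<psi>1 (\<psi>2 y))"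
      by (rule smooth_on_open_compose[OF t1 c2(5)]) auto
    show "(\<lambda>x. \<phi>2 (\<phi>1 x)) ` U \<subseteq> V2" using c2(6) by (auto simp: U_def)
    show "(\<lambda>y. \<psi>1 (\<psi>2 y)) ` V2 \<subseteq> U"
      using m by (simp add: U_def U1_iff \<phi>1\<psi>1 image_subset_iff)
    show "\<psi>1 (\<psi>2 (\<phi>2 (\<phi>1 x))) = x" if "x \<in> U" for x
      using that c2(8) \<psi>1\<phi>1 by (auto simp: U_def)
    show "\<phi>2 (\<phi>1 (\<psi>1 (\<psi>2 y))) = y" if "y \<in> V2" for y
      using that m c2(9) \<phi>1\<psi>1 by simp
  qed
  moreover have "(\<phi>2 \<circ> \<phi>1) ` (two_sheets G w \<inter> U) = P \<inter> V2"
  proof (intro equalityI subsetI)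
    fix y assume "y \<in> (\<phi>2 \<circ> \<phi>1) ` (two_sheets G w \<inter> U)"
    then obtain x where x: "x \<in> two_sheets G w" "x \<in> U1" "\<phi>1 x \<in> U2" "y = \<phi>2 (\<phi>1 x)"
      by (auto simp: U_def)
    then show "y \<in> P \<inter> V2" using N_iff[OF x(2)] P\<phi>2 c2(6) by auto
  next
    fix y assume y: "y \<in> P \<inter> V2"
    define x where "x = \<psi>1 (\<psi>2 y)"
    have m: "\<psi>2 y \<in> U2" "\<psi>2 y \<in> U1" using m y by auto
    have "\<phi>1 x = \<psi>2 y" using m \<phi>1\<psi>1 by (simp add: x_def)
    moreover have "x \<in> U1" using m by (simp add: x_def U1_iff)
    moreover have "\<psi>2 y \<in> N" using y c2(9) P\<phi>2[of "\<psi>2 y"] by simp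
    ultimately have "x \<in> two_sheets G w \<inter> U" "(\<phi>2 \<circ> \<phi>1) x = y"
      using N_iff[of x] m y c2(9)[of y] by (simp_all add: U_def)
    then show "y \<in> (\<phi>2 \<circ> \<phi>1) ` (two_sheets G w \<inter> U)" by (metis image_eqI)
  qed
  moreover have "p \<in> U" using pU1 c2(3) by (simp add: U_def x0_def)
  ultimately show "\<exists>U V (P :: ('a \<times> 'b) set) \<phi>. p \<in> U \<and> open U \<and> open V \<and>
      diffeomorphism_between U V \<phi> \<and> subspace P \<and> dim P = DIM('a) \<and> \<phi> ` (two_sheets G w \<inter> U) = P \<inter> V"
    using openU smooth_on_open_open[OF c2(5)] subP dimP
    by (intro exI[of _ U] exI[of _ V2] exI[of _ P] exI[of _ "\<phi>2 \<circ> \<phi>1"]) simp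
qed

section \<open>A smooth cutoff function\<close>

text \<open>The powers of \<open>1 / t\<close> are carried along so that the family is closed under differentiation; all
  its members are then smooth by one induction.\<close>

definition flat :: "nat \<Rightarrow> real \<Rightarrow> real" where
  "flat m t = (if t > 0 then exp (- (1 / t)) * (1 / t) ^ m else 0)"

text \<open>Comparing \<open>exp (1 / t)\<close> with \<open>(1 + 1 / (k t)) ^ k\<close> for \<open>k = m + 2\<close> leaves two spare powers of
  \<open>t\<close>; a quadratic bound makes the derivative at \<open>0\<close> vanish.\<close>

lemma flat_bound: "\<bar>flat m t\<bar> \<le> real (m + 2) ^ (m + 2) * t\<^sup>2"
proof (cases "t > 0")
  case True
  let ?k = "m + 2"
  have "(1 / (?k * t)) ^ ?k \<le> (1 + (1 / t) / ?k) ^ ?k"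
    using True by (intro power_mono) (simp_all add: field_simps)
  also have "\<dots> \<le> exp (1 / t)"
    by (rule exp_ge_one_plus_x_over_n_power_n)
      (use True in \<open>auto intro: order_trans[of _ 0]\<close>)
  finally have "1 / (real ?k * t) ^ ?k \<le> exp (1 / t)"
    by (simp add: power_divide)
  then have "exp (- (1 / t)) \<le> (real ?k * t) ^ ?k"
    using True by (simp add: exp_minus divide_le_eq le_divide_eq inverse_eq_divide mult.commute)
  also have "\<dots> = real ?k ^ ?k * t\<^sup>2 * t ^ m"
    by (simp only: power_mult_distrib power_add) simp
  finally show ?thesis using True by (simp add: flat_def power_divide divide_le_eq)
qed (simp add: flat_def)

lemma flat_derivative:
  "(flat m has_real_derivative flat (m + 2) t - m * flat (m + 1) t) (at t)"
proof -
  consider "t > 0" | "t < 0" | "t = 0" by linarith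
  then show ?thesis
  proof cases
    case 1
    have "((\<lambda>t. 1 / t) has_real_derivative - ((1 / t) * (1 / t))) (at t)"
      using 1 by (auto intro!: derivative_eq_intros)
    note D = DERIV_mult[OF DERIV_fun_exp[OF DERIV_minus[OF this]] DERIV_power[OF this, of m]]
    have "((\<lambda>t. exp (- (1 / t)) * (1 / t) ^ m) has_real_derivative
        flat (m + 2) t - m * flat (m + 1) t) (at t)"
      by (rule DERIV_cong[OF D]) (use 1 in \<open>cases m; simp add: flat_def algebra_simps\<close>)
    then show ?thesis
      by (rule has_field_derivative_transform_within_open[where S = "{0<..}"])
        (use 1 in \<open>auto simp: flat_def\<close>)
  next
    case 2
    have "((\<lambda>t. 0) has_real_derivative flat (m + 2) t - m * flat (m + 1) t) (at t)"
      using 2 by (simp add: flat_def)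
    then show ?thesis
      by (rule has_field_derivative_transform_within_open[where S = "{..<0}"])
        (use 2 in \<open>auto simp: flat_def\<close>)
  next
    case 3
    have "((\<lambda>h. (flat m (0 + h) - flat m 0) / h) \<longlongrightarrow> 0) (at 0)"
    proof (rule Lim_null_comparison)
      show "\<forall>\<^sub>F h in at 0. norm ((flat m (0 + h) - flat m 0) / h) \<le> real (m + 2) ^ (m + 2) * \<bar>h\<bar>"
      proof (rule eventuallyI)
        fix h :: real
        have "\<bar>flat m h\<bar> / \<bar>h\<bar> \<le> real (m + 2) ^ (m + 2) * h\<^sup>2 / \<bar>h\<bar>"
          by (intro divide_right_mono flat_bound) simp
        also have "\<dots> = real (m + 2) ^ (m + 2) * \<bar>h\<bar>" by (simp add: power2_eq_square abs_if)
        finally show "norm ((flat m (0 + h) - flat m 0) / h) \<le> real (m + 2) ^ (m + 2) * \<bar>h\<bar>"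
          by (simp add: flat_def)
      qed
      show "((\<lambda>h. real (m + 2) ^ (m + 2) * \<bar>h\<bar>) \<longlongrightarrow> (0 :: real)) (at 0)"
        by (auto intro!: tendsto_eq_intros)
    qed
    then show ?thesis using 3 by (simp add: DERIV_def flat_def)
  qed
qed

lemma smooth_flat: "smooth_on_open UNIV (flat m)"
  unfolding smooth_on_open_def
proof (intro conjI allI)
  fix k show "ck_on k UNIV (flat m)"
  proof (induction k arbitrary: m)
    case 0
    show ?case
      using DERIV_isCont[OF flat_derivative] by (simp add: continuous_on_eq_continuous_at)
  next
    case (Suc k)
    have "ck_on k UNIV (\<lambda>t. (flat (m + 2) t + (- real m) * flat (m + 1) t) * v)" for v
      by (intro ck_on_bilinear[OF bounded_bilinear_mult] ck_on_add ck_on_const Suc.IH) auto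
    then show ?case
      using flat_derivative[of m]
      by (intro ck_on_SucI[where D = "\<lambda>t v. (flat (m + 2) t + (- real m) * flat (m + 1) t) * v"])
        (auto simp: has_field_derivative_def)
  qed
qed auto

lemma flat_pos: "t > 0 \<Longrightarrow> flat m t > 0" and flat_zero: "t \<le> 0 \<Longrightarrow> flat m t = 0"
  and flat_nonneg: "flat m t \<ge> 0"
  by (auto simp: flat_def)

text \<open>Strict monotonicity on the transition interval matters later: where the moving boundary
  \<open>G = 0\<close> of a growing domain may be singular in the \<open>x\<close> directions, the \<open>t\<close> derivative has to be
  non-zero. The bound on the slope makes slow transitions possible after rescaling \<open>t\<close>.\<close>

lemma smooth_cutoff:
  obtains \<theta> \<theta>' :: "real \<Rightarrow> real" and B :: real
  where "smooth_on_open UNIV \<theta>" "smooth_on_open UNIV \<theta>'"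
    "\<And>t. (\<theta> has_real_derivative \<theta>' t) (at t)"
    "\<And>t. t \<le> 0 \<Longrightarrow> \<theta> t = 0" "\<And>t. t \<ge> 1 \<Longrightarrow> \<theta> t = 1"
    "\<And>t. t \<le> 0 \<or> t \<ge> 1 \<Longrightarrow> \<theta>' t = 0"
    "\<And>t. 0 < t \<Longrightarrow> t < 1 \<Longrightarrow> 0 < \<theta> t \<and> \<theta> t < 1 \<and> \<theta>' t > 0"
    "B > 0" "\<And>t. \<theta>' t < B"
proof -
  define f where "f = flat 0"
  define f' where "f' = flat 2"
  define s where "s t = f t + f (1 - t)" for t
  define \<theta> where "\<theta> t = f t / s t" for t
  define \<theta>' where "\<theta>' t = (f' t * f (1 - t) + f t * f' (1 - t)) / (s t)\<^sup>2" for t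
  have s: "s t > 0" for t
    using flat_pos[of t 0] flat_pos[of "1 - t" 0] flat_nonneg[of 0 t] flat_nonneg[of 0 "1 - t"]
    by (cases "t > 0") (auto simp: s_def f_def add_pos_nonneg add_nonneg_pos)
  have sf: "smooth_on_open UNIV f" "smooth_on_open UNIV f'"
    by (simp_all add: f_def f'_def smooth_flat)
  have sf': "smooth_on_open UNIV (\<lambda>t. f (1 - t))" "smooth_on_open UNIV (\<lambda>t. f' (1 - t))"
    by (rule smooth_on_open_compose[OF sf(1)] smooth_on_open_compose[OF sf(2)];
        auto intro!: smooth_intros)+
  have ss: "smooth_on_open UNIV s"
    unfolding s_def by (intro smooth_intros sf sf')
  have "smooth_on_open UNIV \<theta>"
    unfolding \<theta>_def by (intro smooth_intros sf ss) (use s in \<open>auto simp: less_imp_neq[symmetric]\<close>)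
  moreover have s\<theta>': "smooth_on_open UNIV \<theta>'"
    unfolding \<theta>'_def
    by (intro smooth_intros sf sf' ss) (use s in \<open>auto simp: less_imp_neq[symmetric]\<close>)
  moreover have "(\<theta> has_real_derivative \<theta>' t) (at t)" for t
  proof -
    have d: "(f has_real_derivative f' t) (at t)" for t
      using flat_derivative[of 0 t] by (simp add: f_def f'_def numeral_2_eq_2)
    have d': "((\<lambda>t. f (1 - t)) has_real_derivative - f' (1 - t)) (at t)" for t
    proof -
      have "((\<lambda>t. 1 - t) has_real_derivative - 1) (at t)"
        by (auto intro!: derivative_eq_intros)
      from DERIV_chain2[where g = "\<lambda>t. 1 - t", OF d this] show ?thesis by simp
    qed
    have "((\<lambda>t. f t / s t) has_real_derivative
        (f' t * s t - f t * (f' t + - f' (1 - t))) / (s t * s t)) (at t)"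
      unfolding s_def by (rule DERIV_divide[OF d DERIV_add[OF d d']]) (use s[of t] in \<open>simp add: s_def\<close>)
    then show ?thesis
      unfolding \<theta>_def[abs_def] \<theta>'_def by (rule DERIV_cong) (simp add: s_def algebra_simps power2_eq_square)
  qed
  moreover have "\<theta> t = 0" if "t \<le> 0" for t
    using that by (simp add: \<theta>_def f_def flat_zero)
  moreover have "\<theta> t = 1" if "t \<ge> 1" for t
    using that s[of t] by (simp add: \<theta>_def s_def f_def flat_zero)
  moreover have z: "\<theta>' t = 0" if "t \<le> 0 \<or> t \<ge> 1" for t
    using that by (auto simp: \<theta>'_def f_def f'_def flat_zero)
  moreover have "0 < \<theta> t \<and> \<theta> t < 1 \<and> \<theta>' t > 0" if "0 < t" "t < 1" for t
    using that s[of t] flat_pos[of t] flat_pos[of "1 - t"]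
    by (auto simp: \<theta>_def \<theta>'_def s_def f_def f'_def intro!: divide_pos_pos add_pos_pos mult_pos_pos)
  moreover obtain B where "B > 0" "\<And>t. \<theta>' t < B"
  proof -
    have "compact (\<theta>' ` {0..1})"
      by (intro compact_continuous_image continuous_on_subset[OF smooth_on_open_continuous[OF s\<theta>']]) auto
    then obtain b where b: "\<forall>t\<in>{0..1}. norm (\<theta>' t) \<le> b"
      using compact_imp_bounded bounded_iff by (metis imageI)
    have "\<theta>' t < \<bar>b\<bar> + 1" for t
      using b z[of t] by (cases "t \<in> {0..1}") (fastforce, auto)
    then show ?thesis using that[of "\<bar>b\<bar> + 1"] by auto
  qed
  ultimately show ?thesis by (rule that)
qed

section \<open>Legendrian and Lagrangian lifts of two-sheeted fronts\<close>

text \<open>Lets the identities between \<open>\<eta>\<close>, \<open>G\<close> and the coordinates on a lift be differentiated along tangent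
  vectors without any mention of curves.\<close>

lemma tangent_space_derivative_zero:
  assumes u: "(u has_derivative D) (at p)" and zero: "\<And>q. q \<in> M \<Longrightarrow> u q = 0"
    and v: "v \<in> tangent_space M p"
  shows "D v = (0 :: 'b::real_normed_vector)"
proof -
  obtain \<epsilon> and \<gamma> :: "real \<Rightarrow> _" where \<gamma>: "\<epsilon> > 0" "\<gamma> ` {-\<epsilon><..<\<epsilon>} \<subseteq> M" "\<gamma> 0 = p"
      "(\<gamma> has_derivative (\<lambda>s. s *\<^sub>R v)) (at 0)"
    using v unfolding tangent_space_def has_vector_derivative_def by auto
  have "((\<lambda>s. u (\<gamma> s)) has_derivative (\<lambda>s. D (s *\<^sub>R v))) (at 0)"
    using has_derivative_compose[OF \<gamma>(4), of u D] u \<gamma>(3) by simp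
  moreover have "((\<lambda>s. u (\<gamma> s)) has_derivative (\<lambda>s. 0)) (at 0)"
    using \<gamma>(1,2) zero
    by (intro has_derivative_transform_within_open[OF has_derivative_const
          open_greaterThanLessThan[of "- \<epsilon>" \<epsilon>]]) (auto simp: image_subset_iff)
  ultimately have "(\<lambda>s. D (s *\<^sub>R v)) = (\<lambda>s. 0)" by (rule has_derivative_unique)
  from fun_cong[OF this, of 1] show ?thesis by simp
qed

text \<open>Recovers \<open>\<eta>\<close> from a point \<open>(q, \<eta> w q)\<close> by a formula that is smooth on a neighbourhood of the
  two sheets in the ambient space.\<close>

definition sheet_parameter ::
  "('a::euclidean_space \<Rightarrow> 'b::euclidean_space) \<Rightarrow> 'a \<times> 'b \<Rightarrow> real" where
  "sheet_parameter w p = (snd p \<bullet> w (fst p)) / (w (fst p) \<bullet> w (fst p))"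

lemma smooth_sheet_parameter:
  assumes w: "smooth_on_open UNIV w"
  shows "smooth_on_open {p :: 'a::euclidean_space \<times> 'b::euclidean_space. w (fst p) \<noteq> 0}
    (sheet_parameter w)"
proof -
  have sw: "smooth_on_open U (\<lambda>p. w (fst p))" if "open U" for U :: "('a \<times> 'b) set"
    by (rule smooth_on_open_compose[OF w smooth_on_open_linear[OF that bounded_linear_fst]]) auto
  have "open {p :: 'a \<times> 'b. w (fst p) \<noteq> 0}"
    using smooth_on_open_continuous[OF sw[OF open_UNIV]] by (intro open_Collect_neq continuous_intros)
  then show ?thesis
    unfolding sheet_parameter_def[abs_def]
    by (intro smooth_intros sw smooth_on_open_linear[OF _ bounded_linear_snd]) auto
qed

lemma sheet_parameter_two_sheets:
  assumes "p \<in> two_sheets G w" and w0: "\<And>q. G q \<ge> 0 \<Longrightarrow> w q \<noteq> 0"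
  shows "w (fst p) \<noteq> 0" "(sheet_parameter w p)\<^sup>2 = G (fst p)"
    "snd p = sheet_parameter w p *\<^sub>R w (fst p)"
proof -
  obtain \<eta> where \<eta>: "\<eta>\<^sup>2 = G (fst p)" "snd p = \<eta> *\<^sub>R w (fst p)"
    using assms(1) by (auto simp: two_sheets_def case_prod_beta)
  show nz: "w (fst p) \<noteq> 0" using w0 \<eta>(1) by (metis zero_le_power2)
  then have "sheet_parameter w p = \<eta>" by (simp add: sheet_parameter_def \<eta>)
  then show "(sheet_parameter w p)\<^sup>2 = G (fst p)" "snd p = sheet_parameter w p *\<^sub>R w (fst p)"
    using \<eta> by simp_all
qed

lemma closed_two_sheets:
  fixes G :: "'a::euclidean_space \<Rightarrow> real" and w :: "'a \<Rightarrow> 'b::euclidean_space"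
  assumes G: "continuous_on UNIV G" and w: "continuous_on UNIV w"
    and w0: "\<And>q. G q \<ge> 0 \<Longrightarrow> w q \<noteq> 0"
  shows "closed (two_sheets G w)"
proof -
  define S where "S = {p :: 'a \<times> 'b. G (fst p) \<ge> 0}"
  define u where "u = (\<lambda>p. ((sheet_parameter w p)\<^sup>2 - G (fst p), snd p - sheet_parameter w p *\<^sub>R w (fst p)))"
  have Gf: "continuous_on X (\<lambda>p. G (fst p))" for X
    by (rule continuous_on_compose2[OF G continuous_on_fst]) auto
  have wf: "continuous_on X (\<lambda>p. w (fst p))" for X
    by (rule continuous_on_compose2[OF w continuous_on_fst]) auto
  have "closed S" unfolding S_def by (intro closed_Collect_le continuous_on_const Gf)
  moreover have "continuous_on S u"
    unfolding u_def sheet_parameter_def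
    by (intro continuous_intros Gf wf) (use w0 in \<open>auto simp: S_def\<close>)
  ultimately have "closed {p \<in> S. u p = 0}"
    by (rule continuous_closed_preimage_constant[rotated])
  moreover have "{p \<in> S. u p = 0} = two_sheets G w"
  proof (intro equalityI subsetI)
    fix p assume "p \<in> {p \<in> S. u p = 0}"
    then show "p \<in> two_sheets G w"
      by (auto simp: u_def two_sheets_def case_prod_beta zero_prod_def)
  next
    fix p assume p: "p \<in> two_sheets G w"
    from sheet_parameter_two_sheets[OF this w0] show "p \<in> {p \<in> S. u p = 0}"
      by (simp add: u_def S_def zero_prod_def) (metis zero_le_power2)
  qed
  ultimately show ?thesis by simp
qed

lemma compact_two_sheets:
  fixes G :: "'a::euclidean_space \<Rightarrow> real" and w :: "'a \<Rightarrow> 'b::euclidean_space"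
  assumes G: "continuous_on UNIV G" and w: "continuous_on UNIV w" and K: "compact K"
  shows "compact (two_sheets G w \<inter> K \<times> UNIV)"
proof -
  obtain E where E: "\<forall>q\<in>K. norm (G q) \<le> E"
    using compact_imp_bounded[OF compact_continuous_image[OF continuous_on_subset[OF G] K]]
    by (auto simp: bounded_iff)
  have Gf: "continuous_on X (\<lambda>p. G (fst p))" and wf: "continuous_on X (\<lambda>p. w (fst p))"
    for X :: "('a \<times> real) set"
    by (rule continuous_on_compose2[OF G continuous_on_fst]
        continuous_on_compose2[OF w continuous_on_fst]; auto)+
  let ?C = "{p. (snd p)\<^sup>2 = G (fst p)} \<inter> K \<times> {- (E + 1)..E + 1}"
  have "compact ?C"
    by (intro closed_Int_compact closed_Collect_eq compact_Times K compact_Icc Gf continuous_intros)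
  then have "compact ((\<lambda>p. (fst p, snd p *\<^sub>R w (fst p))) ` ?C)"
    by (rule compact_continuous_image[rotated]) (intro continuous_intros wf)
  moreover have "(\<lambda>p. (fst p, snd p *\<^sub>R w (fst p))) ` ?C = two_sheets G w \<inter> K \<times> UNIV" (is "?l = ?r")
  proof
    show "?l \<subseteq> ?r" by (auto simp: two_sheets_def)
    show "?r \<subseteq> ?l"
    proof
      fix p assume "p \<in> ?r"
      then obtain q \<eta> where q: "p = (q, \<eta> *\<^sub>R w q)" "\<eta>\<^sup>2 = G q" "q \<in> K"
        by (auto simp: two_sheets_def)
      have \<eta>: "\<eta>\<^sup>2 \<le> E" using E q by force
      then have E0: "E \<ge> 0" by (rule order_trans[OF zero_le_power2])
      then have "E \<le> (E + 1)\<^sup>2" by (simp add: power2_sum)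
      with \<eta> have "\<bar>\<eta>\<bar>\<^sup>2 \<le> (E + 1)\<^sup>2" by simp
      from power2_le_imp_le[OF this] have "\<bar>\<eta>\<bar> \<le> E + 1" using E0 by simp
      with q show "p \<in> ?l" by (intro image_eqI[of _ _ "(q, \<eta>)"]) auto
    qed
  qed
  ultimately show ?thesis by simp
qed

text \<open>With \<open>z = \<eta>\<^sup>3\<close> and \<open>\<eta>\<^sup>2 = G x\<close> one has \<open>dz = 3 \<eta>\<^sup>2 d\<eta> = (3/2) \<eta> dG\<close>, which gives \<open>y\<close>. Writing \<open>z\<close> as
  \<open>\<eta> G x\<close> makes the lift an instance of \<open>two_sheets\<close>. The gradient \<open>dG\<close> is an argument of its own
  so that explicit formulas can be used for it.\<close>

definition legendrian_lift ::
  "(real ^ 'n \<Rightarrow> real) \<Rightarrow> (real ^ 'n \<Rightarrow> real ^ 'n) \<Rightarrow> 'n::finite std set" where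
  "legendrian_lift G dG = two_sheets G (\<lambda>x. ((3 / 2) *\<^sub>R dG x, G x))"

lemma mem_legendrian_lift:
  "(x, y, z) \<in> legendrian_lift G dG \<longleftrightarrow>
    (\<exists>\<eta>. \<eta>\<^sup>2 = G x \<and> y = (3 / 2 * \<eta>) *\<^sub>R dG x \<and> z = \<eta> * G x)"
  by (auto simp: legendrian_lift_def two_sheets_def mult.commute)

lemma contact_form_inner: "contact_form (x, y, z) (dx, dy, dz) = dz - y \<bullet> dx"
  by (simp add: contact_form_def inner_vec_def)

lemma legendrian_legendrian_lift:
  fixes G :: "real ^ 'n::finite \<Rightarrow> real"
  assumes G: "smooth_on_open UNIV G" and dG: "smooth_on_open UNIV dG"
    and der: "\<And>x. (G has_derivative (\<lambda>v. dG x \<bullet> v)) (at x)"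
    and reg: "\<And>x. G x = 0 \<Longrightarrow> dG x \<noteq> 0"
  shows "legendrian (legendrian_lift G dG)"
  unfolding legendrian_def
proof (intro conjI ballI)
  define w where "w = (\<lambda>x. ((3 / 2) *\<^sub>R dG x, G x))"
  have w: "smooth_on_open UNIV w" unfolding w_def by (intro smooth_intros G dG open_UNIV)
  have w0: "w x \<noteq> 0" for x using reg[of x] by (auto simp: w_def zero_prod_def)
  have L: "legendrian_lift G dG = two_sheets G w" by (simp add: legendrian_lift_def w_def)
  show "submanifold CARD('n) (legendrian_lift G dG)"
    using submanifold_two_sheets[OF G dG der reg w w0] by (simp add: L)
  fix p v assume p: "p \<in> legendrian_lift G dG" and v: "v \<in> tangent_space (legendrian_lift G dG) p"
  let ?h = "sheet_parameter w"
  obtain x y z where pe: "p = (x, y, z)" by (cases p)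
  obtain dx dy dz where ve: "v = (dx, dy, dz)" by (cases v)
  have hd: "(?h has_derivative frechet_derivative ?h (at p)) (at p)"
    using smooth_on_open_has_derivative[OF smooth_sheet_parameter[OF w]] w0 by auto
  note h = sheet_parameter_two_sheets[OF _ w0, of _ G]
  have "((\<lambda>p. (?h p)\<^sup>2 - G (fst p)) has_derivative
      (\<lambda>v. 2 * ?h p * frechet_derivative ?h (at p) v - dG (fst p) \<bullet> fst v)) (at p)"
    using has_derivative_compose[OF has_derivative_fst[OF has_derivative_ident] der, of p]
    by (auto intro!: derivative_eq_intros hd)
  from tangent_space_derivative_zero[OF this _ v] h
  have 1: "2 * ?h p * frechet_derivative ?h (at p) v = dG x \<bullet> dx" by (simp add: L ve pe)
  have "((\<lambda>p. snd (snd p) - ?h p ^ 3) has_derivative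
      (\<lambda>v. snd (snd v) - 3 * ?h p ^ 2 * frechet_derivative ?h (at p) v)) (at p)"
    by (auto intro!: derivative_eq_intros hd)
  moreover have "snd (snd q) - ?h q ^ 3 = 0" if "q \<in> legendrian_lift G dG" for q
  proof -
    have "snd (snd q) = ?h q * G (fst q)"
      using h(3)[of q] that by (simp add: L) (simp add: w_def)
    then show ?thesis using h(2)[of q] that by (simp add: L power3_eq_cube power2_eq_square)
  qed
  ultimately have 2: "dz = 3 * (?h p)\<^sup>2 * frechet_derivative ?h (at p) v"
    using tangent_space_derivative_zero[OF _ _ v] by (fastforce simp: ve)
  have "snd p = ?h p *\<^sub>R w x" using h(3)[of p] p by (simp add: L pe)
  then have "y = (3 / 2 * ?h p) *\<^sub>R dG x" by (simp add: pe w_def mult.commute)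
  then have "y \<bullet> dx = 3 / 2 * ?h p * (2 * ?h p * frechet_derivative ?h (at p) v)"
    unfolding 1 by simp
  also have "\<dots> = dz" unfolding 2 by (simp add: power2_eq_square)
  finally show "contact_form p v = 0" by (simp add: pe ve contact_form_inner)
qed

lemma legendrian_lift_homeomorphic:
  fixes G :: "real ^ 'n::finite \<Rightarrow> real"
  assumes G: "smooth_on_open UNIV G" and dG: "smooth_on_open UNIV dG"
    and reg: "\<And>x. G x = 0 \<Longrightarrow> dG x \<noteq> 0"
    and C: "compact {(x, \<eta>). \<eta>\<^sup>2 = G x}"
  shows "{(x, \<eta>). \<eta>\<^sup>2 = G x} homeomorphic legendrian_lift G dG"
proof (rule homeomorphic_compact[OF C])
  let ?w = "\<lambda>x. ((3 / 2) *\<^sub>R dG x, G x)"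
  let ?F = "\<lambda>p. (fst p, snd p *\<^sub>R ?w (fst p))"
  have "continuous_on X (\<lambda>p. G (fst p))" "continuous_on X (\<lambda>p. dG (fst p))" for X :: "(_ \<times> real) set"
    by (rule continuous_on_compose2[OF smooth_on_open_continuous[OF G] continuous_on_fst]
        continuous_on_compose2[OF smooth_on_open_continuous[OF dG] continuous_on_fst]; auto)+
  then show "continuous_on {(x, \<eta>). \<eta>\<^sup>2 = G x} ?F"
    by (intro continuous_intros)
  show "?F ` {(x, \<eta>). \<eta>\<^sup>2 = G x} = legendrian_lift G dG"
    by (force simp: legendrian_lift_def two_sheets_def)
  have nz: "?w x \<noteq> 0" for x using reg[of x] by (auto simp: zero_prod_def)
  show "inj_on ?F {(x, \<eta>). \<eta>\<^sup>2 = G x}"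
    by (intro inj_onI prod_eqI) (use nz in \<open>simp_all only: prod.inject fst_conv scaleR_right_imp_eq real_vector.scale_cancel_right\<close>, auto)
qed

lemma closed_connected_legendrian_lift:
  fixes G :: "real ^ 'n::finite \<Rightarrow> real"
  assumes "smooth_on_open UNIV G" "smooth_on_open UNIV dG"
    and "\<And>x. (G has_derivative (\<lambda>v. dG x \<bullet> v)) (at x)"
    and "\<And>x. G x = 0 \<Longrightarrow> dG x \<noteq> 0"
    and "compact {(x, \<eta>). \<eta>\<^sup>2 = G x}" "connected {(x, \<eta>). \<eta>\<^sup>2 = G x}" "{(x, \<eta>). \<eta>\<^sup>2 = G x} \<noteq> {}"
  shows "closed_connected_legendrian (legendrian_lift G dG)"
  using legendrian_legendrian_lift[OF assms(1-4)] legendrian_lift_homeomorphic[OF assms(1,2,4,5)] assms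
    homeomorphic_compactness homeomorphic_connectedness homeomorphic_empty
  unfolding closed_connected_legendrian_def by metis

text \<open>The gradient of the front \<open>h = e\<^sup>t \<eta>\<^sup>3\<close> with \<open>\<eta>\<^sup>2 = G(t, x)\<close>: its \<open>x\<close> part divided by \<open>e\<^sup>t\<close> is \<open>y\<close>,
  and \<open>z = \<partial>h / \<partial>(e\<^sup>t) = \<eta>\<^sup>3 + (3/2) \<eta> \<partial>\<^sub>t G\<close>.\<close>

definition lagrangian_lift ::
  "(real \<times> (real ^ 'n) \<Rightarrow> real) \<Rightarrow> (real \<times> (real ^ 'n) \<Rightarrow> real \<times> (real ^ 'n)) \<Rightarrow> (real \<times> 'n::finite std) set"
  where "lagrangian_lift G dG = (\<lambda>((t, x), y, z). (t, x, y, z)) `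
    two_sheets G (\<lambda>q. ((3 / 2) *\<^sub>R snd (dG q), G q + 3 / 2 * fst (dG q)))"

lemma mem_lagrangian_lift:
  "(t, x, y, z) \<in> lagrangian_lift G dG \<longleftrightarrow> (\<exists>\<eta>. \<eta>\<^sup>2 = G (t, x) \<and>
     y = (3 / 2 * \<eta>) *\<^sub>R snd (dG (t, x)) \<and> z = \<eta> * (G (t, x) + 3 / 2 * fst (dG (t, x))))"
  by (force simp: lagrangian_lift_def two_sheets_def image_iff mult.commute)

text \<open>The primitive is \<open>f = e\<^sup>t z - h = (3/2) e\<^sup>t \<eta> \<partial>\<^sub>t G\<close>, which vanishes on both ends because \<open>G\<close> does not
  depend on \<open>t\<close> there. Differentiating \<open>\<eta>\<^sup>2 = G\<close> and the formula for \<open>z\<close> along a tangent vector yields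
  \<open>df = e\<^sup>t (dz - y dx)\<close>. At points with \<open>G = 0\<close> the non-degeneracy hypothesis says that \<open>dG \<noteq> 0\<close>.\<close>

lemma exact_lagrangian_cobordism_lift:
  fixes G :: "real \<times> (real ^ 'n::finite) \<Rightarrow> real"
  assumes G: "smooth_on_open UNIV G" and dG: "smooth_on_open UNIV dG"
    and der: "\<And>q. (G has_derivative (\<lambda>v. dG q \<bullet> v)) (at q)"
    and nondeg: "\<And>q. G q \<ge> 0 \<Longrightarrow> snd (dG q) \<noteq> 0 \<or> G q + 3 / 2 * fst (dG q) \<noteq> 0"
    and T: "T > 0"
    and neg: "\<And>t x. t \<le> - T \<Longrightarrow> G (t, x) = Gm x \<and> dG (t, x) = (0, dGm x)"
    and pos: "\<And>t x. t \<ge> T \<Longrightarrow> G (t, x) = Gp x \<and> dG (t, x) = (0, dGp x)"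
    and bound: "\<And>t x. G (t, x) \<ge> 0 \<Longrightarrow> norm x \<le> B"
  shows "exact_lagrangian_cobordism (legendrian_lift Gm dGm) (legendrian_lift Gp dGp)
    (lagrangian_lift G dG)"
proof -
  define A where "A = (\<lambda>p :: (real \<times> (real ^ 'n)) \<times> (real ^ 'n) \<times> real.
    (fst (fst p), snd (fst p), fst (snd p), snd (snd p)))"
  define A' where "A' = (\<lambda>p :: real \<times> (real ^ 'n) \<times> (real ^ 'n) \<times> real.
    ((fst p, fst (snd p)), fst (snd (snd p)), snd (snd (snd p))))"
  have linA: "bounded_linear A" "bounded_linear A'"
    by (auto simp: linear_conv_bounded_linear[symmetric] linear_iff A_def A'_def)
  have inv: "A' (A p) = p" "A (A' q) = q" for p q
    by (simp_all add: A_def A'_def)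
  define w where "w = (\<lambda>q. ((3 / 2) *\<^sub>R snd (dG q), G q + 3 / 2 * fst (dG q)))"
  have w: "smooth_on_open UNIV w" unfolding w_def by (intro smooth_intros G dG open_UNIV)
  have w0: "w q \<noteq> 0" if "G q \<ge> 0" for q using nondeg[OF that] by (auto simp: w_def zero_prod_def)
  have reg: "dG q \<noteq> 0" if "G q = 0" for q using nondeg[of q] that by auto
  have L: "lagrangian_lift G dG = A ` two_sheets G w"
    by (simp add: lagrangian_lift_def w_def A_def case_prod_beta)
  have mem: "p \<in> lagrangian_lift G dG \<longleftrightarrow> A' p \<in> two_sheets G w" for p
    unfolding L using inv by (metis (no_types, lifting) image_iff)
  note cont = smooth_on_open_continuous[OF G] smooth_on_open_continuous[OF w]
  have sub: "submanifold (CARD('n) + 1) (lagrangian_lift G dG)"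
    using submanifold_linear_image[OF linA inv submanifold_two_sheets[OF G dG der reg w w0]]
    by (simp add: L)
  have "closed (A' -` two_sheets G w)"
    using closed_two_sheets[OF cont w0] linear_continuous_on[OF linA(2), of UNIV]
    by (simp add: closed_vimage)
  moreover have "lagrangian_lift G dG = A' -` two_sheets G w" using mem by auto
  ultimately have clo: "closed (lagrangian_lift G dG)" by simp
  have "compact (A ` (two_sheets G w \<inter> ({-T..T} \<times> cball 0 B) \<times> UNIV))"
    by (intro compact_continuous_image linear_continuous_on linA compact_two_sheets cont
        compact_Times compact_cball compact_Icc)
  moreover have "A ` (two_sheets G w \<inter> ({-T..T} \<times> cball 0 B) \<times> UNIV) =
      lagrangian_lift G dG \<inter> {-T..T} \<times> UNIV"
  proof (intro equalityI subsetI)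
    fix p assume "p \<in> lagrangian_lift G dG \<inter> {-T..T} \<times> UNIV"
    then have p: "A' p \<in> two_sheets G w" "fst p \<in> {-T..T}" by (auto simp: mem)
    then have "G (fst p, fst (snd p)) \<ge> 0" by (auto simp: A'_def two_sheets_def) (metis zero_le_power2)
    then have "norm (fst (snd p)) \<le> B" by (rule bound)
    with p have "A' p \<in> two_sheets G w \<inter> ({-T..T} \<times> cball 0 B) \<times> UNIV"
      by (auto simp: A'_def)
    then show "p \<in> A ` (two_sheets G w \<inter> ({-T..T} \<times> cball 0 B) \<times> UNIV)"
      using inv(2) by (metis imageI)
  qed (auto simp: L A_def)
  ultimately have comp: "compact (lagrangian_lift G dG \<inter> {-T..T} \<times> UNIV)" by simp
  have ends: "lagrangian_lift G dG \<inter> {..-T} \<times> UNIV = {..-T} \<times> legendrian_lift Gm dGm"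
    "lagrangian_lift G dG \<inter> {T..} \<times> UNIV = {T..} \<times> legendrian_lift Gp dGp"
    using neg pos by (auto simp: mem_lagrangian_lift mem_legendrian_lift)
  define h where "h p = sheet_parameter w (A' p)" for p
  define f where "f p = 3 / 2 * exp (fst p) * (h p * fst (dG (fst p, fst (snd p))))"
    for p :: "real \<times> 'n std"
  have h: "w (fst p, fst (snd p)) \<noteq> 0" "(h p)\<^sup>2 = G (fst p, fst (snd p))"
    "snd (snd p) = h p *\<^sub>R w (fst p, fst (snd p))" if "p \<in> lagrangian_lift G dG" for p
    using sheet_parameter_two_sheets[OF that[unfolded mem] w0]
    by (simp_all add: h_def) (simp_all add: A'_def)
  define W where "W = {p :: real \<times> 'n std. w (fst p, fst (snd p)) \<noteq> 0}"
  have lin_q: "bounded_linear (\<lambda>p :: real \<times> 'n std. (fst p, fst (snd p)))"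
    by (auto simp: linear_conv_bounded_linear[symmetric] linear_iff)
  have openW: "open W"
  proof -
    have "continuous_on UNIV (\<lambda>p :: real \<times> 'n std. w (fst p, fst (snd p)))"
      by (rule continuous_on_compose2[OF cont(2) linear_continuous_on[OF lin_q]]) auto
    then show ?thesis unfolding W_def by (intro open_Collect_neq continuous_on_const)
  qed
  have sh: "smooth_on_open W h"
    unfolding h_def[abs_def]
    by (rule smooth_on_open_compose[OF smooth_sheet_parameter[OF w] smooth_on_open_linear[OF openW linA(2)]])
      (auto simp: W_def A'_def)
  have sdG: "smooth_on_open W (\<lambda>p. dG (fst p, fst (snd p)))"
    by (rule smooth_on_open_compose[OF dG smooth_on_open_linear[OF openW lin_q]]) auto
  have sf: "smooth_on_open W f"
    unfolding f_def[abs_def]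
    by (intro smooth_intros sh sdG openW smooth_on_open_compose[OF smooth_on_open_exp[OF open_UNIV]
          smooth_on_open_linear[OF openW bounded_linear_fst]]) auto
  have LW: "lagrangian_lift G dG \<subseteq> W" using h(1) by (auto simp: W_def)
  have "differential_is (lagrangian_lift G dG) f liouville_form"
    unfolding differential_is_def
  proof (intro ballI exI conjI)
    fix p assume p: "p \<in> lagrangian_lift G dG"
    obtain t x y z where pe: "p = (t, x, y, z)" by (cases p)
    define m where "m p = h p * fst (dG (fst p, fst (snd p)))" for p
    have sm: "smooth_on_open W m"
      unfolding m_def[abs_def] by (intro smooth_intros sh smooth_on_open_fst[OF sdG])
    have pW: "p \<in> W" using p LW by blast
    note hd = smooth_on_open_has_derivative[OF sh pW]
    note md = smooth_on_open_has_derivative[OF sm pW]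
    let ?h' = "frechet_derivative h (at p)" and ?m' = "frechet_derivative m (at p)"
    let ?D = "\<lambda>v. 3 / 2 * exp (fst p) * (fst v * m p + ?m' v)"
    have "(f has_derivative ?D) (at p)"
      unfolding f_def m_def[symmetric]
      by (auto intro!: derivative_eq_intros md simp: algebra_simps)
    then show "(f has_derivative ?D) (at p within lagrangian_lift G dG)"
      by (rule has_derivative_at_withinI)
    fix v assume v: "v \<in> tangent_space (lagrangian_lift G dG) p"
    obtain dt dx dy dz where ve: "v = (dt, dx, dy, dz)" by (cases v)
    obtain Gt Gx where dGe: "dG (t, x) = (Gt, Gx)" by (cases "dG (t, x)")
    have "((\<lambda>p. (h p)\<^sup>2 - G (fst p, fst (snd p))) has_derivative
        (\<lambda>v. 2 * h p * ?h' v - dG (fst p, fst (snd p)) \<bullet> (fst v, fst (snd v)))) (at p)"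
      using has_derivative_compose[OF bounded_linear_imp_has_derivative[OF lin_q] der, of p UNIV]
      by (auto intro!: derivative_eq_intros hd)
    from tangent_space_derivative_zero[OF this _ v] h(2)
    have 1: "2 * h p * ?h' v = Gt * dt + Gx \<bullet> dx" by (simp add: ve pe dGe)
    have "((\<lambda>p. snd (snd (snd p)) - h p ^ 3 - 3 / 2 * m p) has_derivative
        (\<lambda>v. snd (snd (snd v)) - 3 * h p ^ 2 * ?h' v - 3 / 2 * ?m' v)) (at p)"
      by (auto intro!: derivative_eq_intros hd md)
    moreover have "snd (snd (snd q)) - h q ^ 3 - 3 / 2 * m q = 0" if "q \<in> lagrangian_lift G dG" for q
    proof -
      have "snd (snd (snd q)) = h q * (G (fst q, fst (snd q)) + 3 / 2 * fst (dG (fst q, fst (snd q))))"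
        using h(3)[OF that] by (simp add: w_def)
      then show ?thesis
        using h(2)[OF that] by (simp add: m_def power3_eq_cube power2_eq_square algebra_simps)
    qed
    ultimately have 2: "dz = 3 * (h p)\<^sup>2 * ?h' v + 3 / 2 * ?m' v"
      using tangent_space_derivative_zero[OF _ _ v] by (fastforce simp: ve)
    have y: "y = (3 / 2 * h p) *\<^sub>R Gx" using h(3)[OF p] by (simp add: pe w_def dGe mult.commute)
    have "3 * (h p)\<^sup>2 * ?h' v = 3 / 2 * h p * (2 * h p * ?h' v)" by (simp add: power2_eq_square)
    also have "\<dots> = 3 / 2 * (dt * (h p * Gt)) + ((3 / 2 * h p) *\<^sub>R Gx) \<bullet> dx"
      unfolding 1 by (simp add: algebra_simps)
    also have "\<dots> = 3 / 2 * (dt * m p) + y \<bullet> dx"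
      unfolding y[symmetric] by (simp add: m_def pe dGe)
    finally have "dz - y \<bullet> dx = 3 / 2 * (dt * m p + ?m' v)"
      unfolding 2 by (simp add: algebra_simps)
    then show "?D v = liouville_form p v"
      by (simp add: liouville_form_def pe ve contact_form_inner)
  qed
  moreover have "f constant_on ({..-T} \<times> legendrian_lift Gm dGm)"
    "f constant_on ({T..} \<times> legendrian_lift Gp dGp)"
    unfolding constant_on_def using neg pos
    by (intro exI[of _ 0] ballI; simp add: f_def mem_Times_iff)+
  moreover have "smooth_map_on (lagrangian_lift G dG) f"
    by (rule smooth_on_open_imp_map_on[OF sf LW])
  ultimately show ?thesis
    unfolding exact_lagrangian_cobordism_def using sub clo T ends comp by blast
qed

section \<open>Cobordisms from growing domains\<close>

text \<open>For \<open>t \<le> 0\<close> the cobordism is given by \<open>P\<close>, which may depend on \<open>t\<close> in any admissible way; for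
  \<open>0 \<le> t \<le> 1\<close> it interpolates to \<open>Q\<close>. Points where \<open>P < 0\<close> lie in the interpolated domain only if
  \<open>Q > 0\<close>, so \<open>P < Q\<close> on that domain although it is assumed only where \<open>P \<ge> 0\<close>; hence the
  interpolation increases strictly in \<open>t\<close> there, whatever its \<open>x\<close> gradient does.\<close>

lemma growing_cobordism:
  fixes P :: "real \<times> (real ^ 'n::finite) \<Rightarrow> real" and Q :: "real ^ 'n \<Rightarrow> real"
  assumes P: "smooth_on_open UNIV P" and dP: "smooth_on_open UNIV dP"
    and derP: "\<And>q. (P has_derivative (\<lambda>v. dP q \<bullet> v)) (at q)"
    and Q: "smooth_on_open UNIV Q" and dQ: "smooth_on_open UNIV dQ"
    and derQ: "\<And>x. (Q has_derivative (\<lambda>v. dQ x \<bullet> v)) (at x)"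
    and regQ: "\<And>x. Q x = 0 \<Longrightarrow> dQ x \<noteq> 0"
    and T: "T \<ge> 1"
    and neg: "\<And>t x. t \<le> - T \<Longrightarrow> P (t, x) = Pm x \<and> dP (t, x) = (0, dPm x)"
    and nondeg: "\<And>t x. t \<le> 0 \<Longrightarrow> P (t, x) \<ge> 0 \<Longrightarrow>
      snd (dP (t, x)) \<noteq> 0 \<or> P (t, x) + 3 / 2 * fst (dP (t, x)) \<noteq> 0"
    and stat: "\<And>t x. t \<ge> 0 \<Longrightarrow> fst (dP (t, x)) = 0"
    and less: "\<And>t x. t \<ge> 0 \<Longrightarrow> P (t, x) \<ge> 0 \<Longrightarrow> P (t, x) < Q x"
    and bound: "\<And>t x. P (t, x) \<ge> 0 \<Longrightarrow> norm x \<le> B" "\<And>x. Q x \<ge> 0 \<Longrightarrow> norm x \<le> B"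
  shows "\<exists>L. exact_lagrangian_cobordism (legendrian_lift Pm dPm) (legendrian_lift Q dQ) L"
proof -
  obtain \<theta> \<theta>' :: "real \<Rightarrow> real" and C :: real
    where \<theta>: "smooth_on_open UNIV \<theta>" "smooth_on_open UNIV \<theta>'"
      "\<And>t. (\<theta> has_real_derivative \<theta>' t) (at t)"
      "\<And>t. t \<le> 0 \<Longrightarrow> \<theta> t = 0" "\<And>t. t \<ge> 1 \<Longrightarrow> \<theta> t = 1"
      "\<And>t. t \<le> 0 \<or> t \<ge> 1 \<Longrightarrow> \<theta>' t = 0"
      "\<And>t. 0 < t \<Longrightarrow> t < 1 \<Longrightarrow> 0 < \<theta> t \<and> \<theta> t < 1 \<and> \<theta>' t > 0"
    using smooth_cutoff by metis
  have \<theta>01: "0 \<le> \<theta> t" "\<theta> t \<le> 1" for t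
    using \<theta>(4)[of t] \<theta>(5)[of t] \<theta>(7)[of t] by (cases "t \<le> 0"; cases "t \<ge> 1"; force)+
  define G where "G q = (1 - \<theta> (fst q)) * P q + \<theta> (fst q) * Q (snd q)" for q
  define dG where "dG q = (\<theta>' (fst q) * (Q (snd q) - P q) + (1 - \<theta> (fst q)) * fst (dP q),
      (1 - \<theta> (fst q)) *\<^sub>R snd (dP q) + \<theta> (fst q) *\<^sub>R dQ (snd q))" for q
  have \<theta>f: "smooth_on_open UNIV (\<lambda>q :: real \<times> (real ^ 'n). \<theta> (fst q))"
      "smooth_on_open UNIV (\<lambda>q :: real \<times> (real ^ 'n). \<theta>' (fst q))"
    by (intro smooth_on_open_compose_linear[OF \<theta>(1)] smooth_on_open_compose_linear[OF \<theta>(2)]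
        bounded_linear_fst open_UNIV)+
  have Qs: "smooth_on_open UNIV (\<lambda>q :: real \<times> (real ^ 'n). Q (snd q))"
      "smooth_on_open UNIV (\<lambda>q :: real \<times> (real ^ 'n). dQ (snd q))"
    by (intro smooth_on_open_compose_linear[OF Q] smooth_on_open_compose_linear[OF dQ]
        bounded_linear_snd open_UNIV)+
  have "smooth_on_open UNIV G" unfolding G_def[abs_def]
    by (intro smooth_intros \<theta>f Qs P open_UNIV)
  moreover have "smooth_on_open UNIV dG" unfolding dG_def[abs_def]
    by (intro smooth_intros \<theta>f Qs P dP open_UNIV)
  moreover have "(G has_derivative (\<lambda>v. dG q \<bullet> v)) (at q)" for q
  proof -
    have "((\<lambda>q. \<theta> (fst q)) has_derivative (\<lambda>v. \<theta>' (fst q) * fst v)) (at q)"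
      by (rule has_derivative_compose[OF has_derivative_fst[OF has_derivative_ident]
            \<theta>(3)[unfolded has_field_derivative_def]])
    moreover have "((\<lambda>q. Q (snd q)) has_derivative (\<lambda>v. dQ (snd q) \<bullet> snd v)) (at q)"
      by (rule has_derivative_compose[OF has_derivative_snd[OF has_derivative_ident] derQ])
    ultimately show ?thesis
      unfolding G_def[abs_def]
      by (auto intro!: derivative_eq_intros derP
          simp: dG_def fun_eq_iff inner_prod_def algebra_simps)
  qed
  moreover have "snd (dG q) \<noteq> 0 \<or> G q + 3 / 2 * fst (dG q) \<noteq> 0" if "G q \<ge> 0" for q
  proof -
    obtain t x where q: "q = (t, x)" by (cases q)
    consider "t \<le> 0" | "0 < t" "t < 1" | "t \<ge> 1" by linarith
    then show ?thesis
    proof cases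
      case 1
      then show ?thesis using that nondeg by (simp add: q G_def dG_def \<theta>)
    next
      case 2
      note \<theta>t = \<theta>(7)[OF 2]
      have "P (t, x) < Q x"
      proof (cases "P (t, x) \<ge> 0")
        case True
        then show ?thesis using less 2 by simp
      next
        case False
        then have "(1 - \<theta> t) * P (t, x) < 0" using \<theta>t by (simp add: mult_pos_neg)
        with that have "\<theta> t * Q x > 0" by (simp add: q G_def)
        then show ?thesis using False \<theta>t by (simp add: zero_less_mult_iff)
      qed
      then have "fst (dG q) > 0" using \<theta>t 2 by (simp add: q dG_def stat)
      then show ?thesis using that by auto
    next
      case 3
      then show ?thesis using that regQ by (auto simp: q G_def dG_def \<theta> stat)
    qed
  qed
  moreover have "G (t, x) = Pm x \<and> dG (t, x) = (0, dPm x)" if "t \<le> - T" for t x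
    using that T neg[OF that] by (simp add: G_def dG_def \<theta>)
  moreover have "G (t, x) = Q x \<and> dG (t, x) = (0, dQ x)" if "t \<ge> T" for t x
    using that T by (simp add: G_def dG_def \<theta> stat)
  moreover have "norm x \<le> B" if "G (t, x) \<ge> 0" for t x
  proof (rule ccontr)
    assume "\<not> norm x \<le> B"
    then have "\<not> P (t, x) \<ge> 0" "\<not> Q x \<ge> 0" using bound(1)[of t x] bound(2)[of x] by blast+
    then have "P (t, x) < 0" "Q x < 0" by simp_all
    moreover have "(1 - \<theta> t) * P (t, x) \<le> 0"
      using \<open>P (t, x) < 0\<close> \<theta>01[of t] by (simp add: mult_nonneg_nonpos)
    moreover have "\<theta> t = 0 \<or> \<theta> t * Q x < 0"
      using \<open>Q x < 0\<close> \<theta>01[of t] by (auto simp: mult_less_0_iff)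
    ultimately show False using that by (auto simp: G_def)
  qed
  ultimately show ?thesis
    using exact_lagrangian_cobordism_lift[of G dG T Pm dPm Q dQ B] T by auto
qed

section \<open>The ball and the shell\<close>

text \<open>The parameter of the ball is the square of its radius. The shell is
  \<open>1/2 \<le> \<bar>x - e\<bar>\<^sup>2 \<le> 3/2\<close>; for \<open>\<bar>e\<bar> = 1\<close> it contains the ball of radius \<open>1/8\<close> around the origin and
  lies in the ball of radius \<open>3\<close>.\<close>

definition ball_fun :: "real \<Rightarrow> real ^ 'n::finite \<Rightarrow> real" where
  "ball_fun r x = r - x \<bullet> x"

definition shell_fun :: "real ^ 'n::finite \<Rightarrow> real ^ 'n \<Rightarrow> real" where
  "shell_fun e x = 1 / 4 - ((x - e) \<bullet> (x - e) - 1)\<^sup>2"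

definition shell_grad :: "real ^ 'n::finite \<Rightarrow> real ^ 'n \<Rightarrow> real ^ 'n" where
  "shell_grad e x = (- 4 * ((x - e) \<bullet> (x - e) - 1)) *\<^sub>R (x - e)"

abbreviation ball_legendrian :: "'n::finite std set" where
  "ball_legendrian \<equiv> legendrian_lift (ball_fun 9) (\<lambda>x. - 2 *\<^sub>R x)"

abbreviation shell_legendrian :: "real ^ 'n \<Rightarrow> 'n::finite std set" where
  "shell_legendrian e \<equiv> legendrian_lift (shell_fun e) (shell_grad e)"

lemma smooth_ball_fun: "smooth_on_open UNIV (ball_fun r)" "smooth_on_open UNIV (\<lambda>x. - 2 *\<^sub>R x)"
  and ball_fun_derivative: "(ball_fun r has_derivative (\<lambda>v. (- 2 *\<^sub>R x) \<bullet> v)) (at x)"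
  unfolding ball_fun_def[abs_def]
  by (intro smooth_intros open_UNIV smooth_on_open_linear bounded_linear_scaleR_right)+
    (auto intro!: derivative_eq_intros simp: inner_commute)

lemma smooth_shell_fun: "smooth_on_open UNIV (shell_fun e)" "smooth_on_open UNIV (shell_grad e)"
  and shell_fun_derivative: "(shell_fun e has_derivative (\<lambda>v. shell_grad e x \<bullet> v)) (at x)"
  unfolding shell_fun_def[abs_def] shell_grad_def[abs_def]
  by (intro smooth_intros open_UNIV)+
    (auto intro!: derivative_eq_intros simp: inner_commute algebra_simps)

lemma ball_regular: "ball_fun 9 x = 0 \<Longrightarrow> - 2 *\<^sub>R x \<noteq> 0"
  by (auto simp: ball_fun_def)

lemma shell_fun_nonneg:
  assumes "shell_fun e x \<ge> 0"
  shows "1 / 2 \<le> (x - e) \<bullet> (x - e)" "(x - e) \<bullet> (x - e) \<le> 3 / 2"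
proof -
  have "\<bar>(x - e) \<bullet> (x - e) - 1\<bar>\<^sup>2 \<le> (1 / 2)\<^sup>2"
    using assms by (simp add: shell_fun_def power_divide)
  then have "\<bar>(x - e) \<bullet> (x - e) - 1\<bar> \<le> 1 / 2" by (rule power2_le_imp_le) simp
  then show "1 / 2 \<le> (x - e) \<bullet> (x - e)" "(x - e) \<bullet> (x - e) \<le> 3 / 2" by linarith+
qed

lemma shell_regular:
  assumes "shell_fun e x = 0"
  shows "shell_grad e x \<noteq> 0"
proof -
  have "(x - e) \<bullet> (x - e) - 1 \<noteq> 0" using assms by (auto simp: shell_fun_def)
  moreover have "x - e \<noteq> 0" using shell_fun_nonneg[of e x] assms by auto
  ultimately show ?thesis by (simp add: shell_grad_def)
qed

lemma shell_fun_bound: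
  assumes "norm e = 1" "shell_fun e x \<ge> 0"
  shows "norm x \<le> 5 / 2"
proof -
  have "(norm (x - e))\<^sup>2 \<le> (3 / 2)\<^sup>2"
    using shell_fun_nonneg[OF assms(2)] by (simp add: power2_norm_eq_inner power_divide)
  then have "norm (x - e) \<le> 3 / 2" by (rule power2_le_imp_le) simp
  then show ?thesis using norm_triangle_ineq[of "x - e" e] assms(1) by simp
qed

lemma ball_fun_bound: "ball_fun r x \<ge> 0 \<Longrightarrow> r \<le> 9 \<Longrightarrow> norm x \<le> 3"
  by (rule power2_le_imp_le) (simp_all add: ball_fun_def power2_norm_eq_inner)

lemma shell_less_ball:
  assumes "norm e = 1" "shell_fun e x \<ge> 0"
  shows "shell_fun e x < ball_fun 9 x"
proof -
  have "(norm x)\<^sup>2 \<le> (5 / 2)\<^sup>2"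
    using shell_fun_bound[OF assms] by (intro power_mono) auto
  then have "x \<bullet> x \<le> 25 / 4" by (simp add: power2_norm_eq_inner power_divide)
  moreover have "shell_fun e x \<le> 1 / 4" by (simp add: shell_fun_def)
  ultimately show ?thesis by (simp add: ball_fun_def)
qed

lemma small_ball_less_shell:
  assumes "norm e = 1" "ball_fun (1 / 64) x \<ge> 0"
  shows "ball_fun (1 / 64) x < shell_fun e x"
proof -
  have s: "(norm x)\<^sup>2 \<le> (1 / 8)\<^sup>2"
    using assms(2) by (simp add: ball_fun_def power2_norm_eq_inner power_divide)
  then have "norm x \<le> 1 / 8" by (rule power2_le_imp_le) simp
  then have "\<bar>x \<bullet> e\<bar> \<le> 1 / 8"
    using Cauchy_Schwarz_ineq2[of x e] assms(1) by simp
  moreover have "(x - e) \<bullet> (x - e) - 1 = x \<bullet> x - 2 * (x \<bullet> e)"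
    using assms(1) by (simp add: inner_diff inner_commute norm_eq_1)
  moreover have "0 \<le> x \<bullet> x" "x \<bullet> x \<le> 1 / 64"
    using s by (simp_all add: power2_norm_eq_inner power_divide)
  ultimately have "\<bar>(x - e) \<bullet> (x - e) - 1\<bar> \<le> 17 / 64" by linarith
  then have "\<bar>(x - e) \<bullet> (x - e) - 1\<bar>\<^sup>2 \<le> (17 / 64)\<^sup>2" by (intro power_mono) auto
  then have "((x - e) \<bullet> (x - e) - 1)\<^sup>2 \<le> 289 / 4096" by (simp add: power_divide)
  then show ?thesis
    unfolding shell_fun_def ball_fun_def using \<open>0 \<le> x \<bullet> x\<close> by linarith
qed

lemma cobordism_shell_ball:
  fixes e :: "real ^ 'n::finite"
  assumes e: "norm e = 1"
  shows "\<exists>L. exact_lagrangian_cobordism (shell_legendrian e) ball_legendrian L"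
proof (rule growing_cobordism[where P = "\<lambda>q. shell_fun e (snd q)" and
      dP = "\<lambda>q. (0, shell_grad e (snd q))" and T = 1 and B = 3])
  show "smooth_on_open UNIV (\<lambda>q :: real \<times> _. shell_fun e (snd q))"
    by (intro smooth_on_open_compose_linear[OF smooth_shell_fun(1)] bounded_linear_snd open_UNIV)
  have "smooth_on_open UNIV (\<lambda>q :: real \<times> _. shell_grad e (snd q))"
    by (intro smooth_on_open_compose_linear[OF smooth_shell_fun(2)] bounded_linear_snd open_UNIV)
  then show "smooth_on_open UNIV (\<lambda>q :: real \<times> _. (0 :: real, shell_grad e (snd q)))"
    by (intro smooth_intros open_UNIV)
  show "((\<lambda>q. shell_fun e (snd q)) has_derivative (\<lambda>v. (0, shell_grad e (snd q)) \<bullet> v)) (at q)"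
    for q :: "real \<times> _"
    using has_derivative_compose[OF has_derivative_snd[OF has_derivative_ident] shell_fun_derivative]
    by (simp add: inner_prod_def)
  show "norm x \<le> 3" if "shell_fun e (snd (t, x)) \<ge> 0" for t :: real and x
    using shell_fun_bound[OF e] that by fastforce
  show "snd (0 :: real, shell_grad e (snd (t, x))) \<noteq> 0 \<or>
      shell_fun e (snd (t, x)) + 3 / 2 * fst (0, shell_grad e (snd (t, x))) \<noteq> 0" for t :: real and x
    using shell_regular[of e x] by (cases "shell_fun e x = 0") simp_all
  show "norm x \<le> 3" if "ball_fun 9 x \<ge> 0" for x :: "real ^ 'n"
    using ball_fun_bound[OF that] by simp
qed (use smooth_ball_fun ball_fun_derivative ball_regular shell_less_ball[OF e] in auto)

text \<open>For negative \<open>t\<close> the ball \<open>\<bar>x\<bar>\<^sup>2 \<le> k t\<close> shrinks from squared radius \<open>9\<close> to \<open>1/64\<close>. The \<open>x\<close> gradient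
  vanishes only at the centre, where the condition is \<open>k + (3/2) k' > 0\<close>: the squared radius has to decrease
  more slowly than \<open>e\<^sup>-\<^sup>2\<^sup>t\<^sup>/\<^sup>3\<close>. The small ball then grows into the shell.\<close>

lemma cobordism_ball_shell:
  fixes e :: "real ^ 'n::finite"
  assumes e: "norm e = 1"
  shows "\<exists>L. exact_lagrangian_cobordism ball_legendrian (shell_legendrian e) L"
proof -
  obtain \<theta> \<theta>' :: "real \<Rightarrow> real" and C :: real
    where \<theta>: "smooth_on_open UNIV \<theta>" "smooth_on_open UNIV \<theta>'"
      "\<And>t. (\<theta> has_real_derivative \<theta>' t) (at t)"
      "\<And>t. t \<le> 0 \<Longrightarrow> \<theta> t = 0" "\<And>t. t \<ge> 1 \<Longrightarrow> \<theta> t = 1"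
      "\<And>t. t \<le> 0 \<or> t \<ge> 1 \<Longrightarrow> \<theta>' t = 0"
      "\<And>t. 0 < t \<Longrightarrow> t < 1 \<Longrightarrow> 0 < \<theta> t \<and> \<theta> t < 1 \<and> \<theta>' t > 0"
      and C: "C > 0" "\<And>t. \<theta>' t < C"
    by (rule smooth_cutoff) blast
  \<comment> \<open>Any \<open>\<delta>\<close> with \<open>(3/2) (575/64) \<delta> C < 1/64\<close> is slow enough, since \<open>k \<ge> 1/64\<close>.\<close>
  define \<delta> where "\<delta> = 1 / (1000 * C + 1)"
  have \<delta>: "\<delta> > 0" "\<delta> \<le> 1" "\<delta> * C \<le> 1 / 1000"
    using C(1) by (auto simp: \<delta>_def field_simps)
  have \<theta>01: "0 \<le> \<theta> t" "\<theta> t \<le> 1" "0 \<le> \<theta>' t" for t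
    using \<theta>(4)[of t] \<theta>(5)[of t] \<theta>(6)[of t] \<theta>(7)[of t] by (cases "t \<le> 0"; cases "t \<ge> 1"; force)+
  define k where "k t = 9 - 575 / 64 * \<theta> (1 + \<delta> * t)" for t
  define k' where "k' t = - 575 / 64 * (\<theta>' (1 + \<delta> * t) * \<delta>)" for t
  have sk: "smooth_on_open UNIV k" "smooth_on_open UNIV k'"
    unfolding k_def[abs_def] k'_def[abs_def]
    by (intro smooth_intros smooth_on_open_compose[OF \<theta>(1)] smooth_on_open_compose[OF \<theta>(2)]
        open_UNIV subset_UNIV)+
  have dk: "(k has_real_derivative k' t) (at t)" for t
  proof -
    have "((\<lambda>t. 1 + \<delta> * t) has_real_derivative \<delta>) (at t)"
      by (auto intro!: derivative_eq_intros)
    from DERIV_chain2[where g = "\<lambda>t. 1 + \<delta> * t", OF \<theta>(3) this] show ?thesis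
      unfolding k_def[abs_def] k'_def by (auto intro!: derivative_eq_intros)
  qed
  have k_le: "1 / 64 \<le> k t" "k t \<le> 9" for t
    using \<theta>01[of "1 + \<delta> * t"] by (simp_all add: k_def)
  have speed: "k t + 3 / 2 * k' t > 0" for t
  proof -
    have "\<theta>' (1 + \<delta> * t) * \<delta> \<le> 1 / 1000"
      using mult_right_mono[OF less_imp_le[OF C(2)[of "1 + \<delta> * t"]] less_imp_le[OF \<delta>(1)]] \<delta>(3)
      by (simp add: mult.commute)
    then show ?thesis using k_le(1)[of t] unfolding k'_def by linarith
  qed
  show ?thesis
  proof (rule growing_cobordism[where P = "\<lambda>q. k (fst q) - snd q \<bullet> snd q" and
        dP = "\<lambda>q. (k' (fst q), - 2 *\<^sub>R snd q)" and T = "1 / \<delta>" and B = 3])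
    have kf: "smooth_on_open UNIV (\<lambda>q :: real \<times> (real ^ 'n). k (fst q))"
      "smooth_on_open UNIV (\<lambda>q :: real \<times> (real ^ 'n). k' (fst q))"
      by (intro smooth_on_open_compose_linear[OF sk(1)] smooth_on_open_compose_linear[OF sk(2)]
          bounded_linear_fst open_UNIV)+
    show "smooth_on_open UNIV (\<lambda>q :: real \<times> (real ^ 'n). k (fst q) - snd q \<bullet> snd q)"
      "smooth_on_open UNIV (\<lambda>q :: real \<times> (real ^ 'n). (k' (fst q), - 2 *\<^sub>R snd q))"
      by (intro smooth_intros kf open_UNIV smooth_on_open_linear bounded_linear_snd)+
    show "((\<lambda>q. k (fst q) - snd q \<bullet> snd q) has_derivative
        (\<lambda>v. (k' (fst q), - 2 *\<^sub>R snd q) \<bullet> v)) (at q)" for q :: "real \<times> (real ^ 'n)"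
    proof -
      have "((\<lambda>q. k (fst q)) has_derivative (\<lambda>v. k' (fst q) * fst v)) (at q)"
        by (rule has_derivative_compose[OF has_derivative_fst[OF has_derivative_ident]
              dk[unfolded has_field_derivative_def]])
      then show ?thesis
        by (auto intro!: derivative_eq_intros simp: inner_prod_def inner_commute)
    qed
    show "1 \<le> 1 / \<delta>" using \<delta> by (simp add: field_simps)
    show "k (fst (t, x)) - snd (t, x) \<bullet> snd (t, x) = ball_fun 9 x \<and>
        (k' (fst (t, x)), - 2 *\<^sub>R snd (t, x)) = (0, - 2 *\<^sub>R x)" if "t \<le> - (1 / \<delta>)" for t and x :: "real ^ 'n"
    proof -
      have "1 + \<delta> * t \<le> 0" using that \<delta>(1) by (simp add: field_simps)
      then show ?thesis by (simp add: k_def k'_def \<theta> ball_fun_def)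
    qed
    show "snd (k' (fst (t, x)), - 2 *\<^sub>R snd (t, x)) \<noteq> 0 \<or>
        k (fst (t, x)) - snd (t, x) \<bullet> snd (t, x) +
          3 / 2 * fst (k' (fst (t, x)), - 2 *\<^sub>R snd (t, x)) \<noteq> 0" for t and x :: "real ^ 'n"
      using speed[of t] by (cases "x = 0") auto
    have k0: "k t = 1 / 64" "k' t = 0" if "t \<ge> 0" for t
    proof -
      have "1 + \<delta> * t \<ge> 1" using that \<delta>(1) by simp
      then show "k t = 1 / 64" "k' t = 0" by (simp_all add: k_def k'_def \<theta>)
    qed
    show "fst (k' (fst (t, x)), - 2 *\<^sub>R snd (t, x)) = 0" if "t \<ge> 0" for t and x :: "real ^ 'n"
      using k0[OF that] by simp
    show "k (fst (t, x)) - snd (t, x) \<bullet> snd (t, x) < shell_fun e x"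
      if "t \<ge> 0" "0 \<le> k (fst (t, x)) - snd (t, x) \<bullet> snd (t, x)" for t x
      using that small_ball_less_shell[OF e, of x] k0(1)[OF that(1)] by (simp add: ball_fun_def)
    show "norm x \<le> 3" if "0 \<le> k (fst (t, x)) - snd (t, x) \<bullet> snd (t, x)" for t and x :: "real ^ 'n"
      using that ball_fun_bound[of "k t" x] k_le(2)[of t] by (simp add: ball_fun_def)
    show "norm x \<le> 3" if "shell_fun e x \<ge> 0" for x
      using shell_fun_bound[OF e that] by simp
    show "shell_grad e x \<noteq> 0" if "shell_fun e x = 0" for x
      using that by (rule shell_regular)
  qed (use smooth_shell_fun shell_fun_derivative in auto)
qed

section \<open>The two Legendrians are not homeomorphic\<close>

lemma ball_double: "{(x, \<eta>). \<eta>\<^sup>2 = ball_fun 9 x} = sphere (0 :: (real ^ 'n::finite) \<times> real) 3"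
proof -
  have "\<eta>\<^sup>2 = 9 - x \<bullet> x \<longleftrightarrow> norm (x, \<eta>) = 3" for x :: "real ^ 'n" and \<eta> :: real
  proof -
    have "norm (x, \<eta>) = 3 \<longleftrightarrow> (norm (x, \<eta>))\<^sup>2 = 3\<^sup>2"
      by (metis norm_ge_zero power2_eq_iff_nonneg zero_le_numeral)
    also have "(norm (x, \<eta>))\<^sup>2 = x \<bullet> x + \<eta>\<^sup>2"
      by (simp add: norm_Pair power2_norm_eq_inner)
    finally show ?thesis by auto
  qed
  then show ?thesis by (auto simp: ball_fun_def)
qed

lemma ball_double_topology:
  assumes "CARD('n::finite) > 1"
  shows "compact {(x :: real ^ 'n, \<eta>). \<eta>\<^sup>2 = ball_fun 9 x}"
    "connected {(x :: real ^ 'n, \<eta>). \<eta>\<^sup>2 = ball_fun 9 x}"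
    "{(x :: real ^ 'n, \<eta>). \<eta>\<^sup>2 = ball_fun 9 x} \<noteq> {}"
    "simply_connected {(x :: real ^ 'n, \<eta>). \<eta>\<^sup>2 = ball_fun 9 x}"
  unfolding ball_double using assms
  by (auto intro!: connected_sphere simply_connected_sphere)

text \<open>Polar coordinates around \<open>e\<close> identify the double with \<open>S\<^sup>1 \<times> S\<^sup>n\<^sup>-\<^sup>1\<close>; the second factor is
  connected because \<open>n > 1\<close>. Composing the inclusion of a circle factor with the projection to \<open>S\<^sup>1\<close> gives
  the identity, which would be null-homotopic if the double were simply connected.\<close>

lemma shell_double_topology:
  fixes e :: "real ^ 'n::finite"
  assumes "CARD('n) > 1"
  defines "C \<equiv> {(x :: real ^ 'n, \<eta>). \<eta>\<^sup>2 = shell_fun e x}"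
  shows "compact C" "connected C" "C \<noteq> {}" "\<not> simply_connected C"
proof -
  let ?F = "\<lambda>(c :: complex, u :: real ^ 'n). (e + sqrt (1 + Re c / 2) *\<^sub>R u, Im c / 2)"
  let ?S = "sphere 0 1 \<times> sphere 0 1 :: (complex \<times> (real ^ 'n)) set"
  have unit: "(Re c)\<^sup>2 + (Im c)\<^sup>2 = 1" "\<bar>Re c\<bar> \<le> 1" if "c \<in> sphere 0 1" for c :: complex
    using that abs_Re_le_cmod[of c] cmod_power2[of c] by auto
  have radius: "(sqrt (1 + Re c / 2))\<^sup>2 = 1 + Re c / 2" if "c \<in> sphere 0 1" for c
    using unit[OF that] by simp
  have C_iff: "(x, \<eta>) \<in> C \<longleftrightarrow>
      Complex (2 * ((x - e) \<bullet> (x - e) - 1)) (2 * \<eta>) \<in> sphere 0 1" for x \<eta>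
  proof -
    have "\<eta>\<^sup>2 = 1 / 4 - s\<^sup>2 \<longleftrightarrow> Complex (2 * s) (2 * \<eta>) \<in> sphere 0 1" for s
      by (auto simp: cmod_def power_mult_distrib)
    then show ?thesis by (simp only: C_def shell_fun_def mem_Collect_eq case_prod_conv)
  qed
  have fim: "?F ` ?S = C"
  proof (intro equalityI subsetI)
    fix p assume "p \<in> ?F ` ?S"
    then obtain c u where cu: "c \<in> sphere 0 1" "u \<bullet> u = 1"
        "p = (e + sqrt (1 + Re c / 2) *\<^sub>R u, Im c / 2)"
      by (auto simp: norm_eq_1)
    then show "p \<in> C"
      using radius[OF cu(1)] by (simp add: C_iff power2_eq_square)
  next
    fix p assume p: "p \<in> C"
    obtain x \<eta> where pe: "p = (x, \<eta>)" by (cases p)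
    let ?c = "Complex (2 * ((x - e) \<bullet> (x - e) - 1)) (2 * \<eta>)"
    have c: "?c \<in> sphere 0 1" using p by (simp only: pe C_iff)
    have n: "sqrt (1 + Re ?c / 2) = norm (x - e)"
      by (simp add: norm_eq_sqrt_inner diff_divide_distrib)
    have "shell_fun e x \<ge> 0" using p by (auto simp: pe C_def) (metis zero_le_power2)
    then have nz: "x - e \<noteq> 0" using shell_fun_nonneg[of e x] by auto
    have "p = ?F (?c, (x - e) /\<^sub>R norm (x - e))"
      using n nz by (simp add: pe)
    moreover have "(?c, (x - e) /\<^sub>R norm (x - e)) \<in> ?S" using c nz by simp
    ultimately show "p \<in> ?F ` ?S" by blast
  qed
  have Fc: "continuous_on ?S ?F"
    unfolding case_prod_beta by (intro continuous_intros) auto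
  show "compact C"
    using compact_continuous_image[OF Fc] fim by (simp add: compact_Times)
  show "connected C"
    using connected_continuous_image[OF Fc] fim assms(1)
    by (simp add: connected_Times connected_sphere)
  obtain u :: "real ^ 'n" where u: "norm u = 1" using vector_choose_size[of 1] by auto
  then have "?F (1, u) \<in> ?F ` ?S" by (intro imageI) simp
  then show "C \<noteq> {}" unfolding fim by blast
  show "\<not> simply_connected C"
  proof
    assume sc: "simply_connected C"
    define f where "f c = ?F (c, u)" for c
    define r where "r = (\<lambda>p :: (real ^ 'n) \<times> real.
      Complex (2 * ((fst p - e) \<bullet> (fst p - e) - 1)) (2 * snd p))"
    have fC: "f \<in> sphere 0 1 \<rightarrow> C"
    proof (rule Pi_I)
      fix c :: complex assume "c \<in> sphere 0 1"
      then have "?F (c, u) \<in> ?F ` ?S" using u by (intro imageI) simp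
      then show "f c \<in> C" unfolding fim f_def .
    qed
    have "continuous_on (sphere 0 1) f"
      unfolding f_def case_prod_beta by (auto intro!: continuous_intros)
    then have "homotopic_with_canon (\<lambda>h. True) (sphere 0 1) C f (\<lambda>c. f 1)"
      using fC by (intro simply_connected_eq_homotopic_circlemaps1[OF sc]) (auto simp: Pi_iff)
    moreover have "continuous_on C r"
      unfolding r_def Complex_eq by (intro continuous_intros)
    moreover have "r \<in> C \<rightarrow> sphere 0 1"
      using C_iff by (auto simp: r_def simp del: mem_sphere_0)
    ultimately have "homotopic_with_canon (\<lambda>h. True) (sphere 0 1) (sphere 0 1) (r \<circ> f) (r \<circ> (\<lambda>c. f 1))"
      by (rule homotopic_with_compose_continuous_left)
    moreover have "(r \<circ> f) c = id c" if "c \<in> sphere 0 1" for c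
      using radius[OF that] u
      by (simp add: r_def f_def complex_eq_iff norm_eq_1 power2_eq_square)
    ultimately have "homotopic_with_canon (\<lambda>h. True) (sphere 0 1) (sphere 0 1) id (\<lambda>c :: complex. r (f 1))"
      by (elim homotopic_with_eq) auto
    then have "contractible (sphere (0 :: complex) 1)"
      unfolding contractible_def by blast
    then show False by (simp add: contractible_sphere)
  qed
qed

lemma legendrian_isotopic_imp_homeomorphic:
  assumes "legendrian_isotopic \<Lambda> \<Lambda>'"
  shows "\<Lambda> homeomorphic \<Lambda>'"
proof -
  obtain \<Phi> where \<Phi>: "\<forall>t\<in>{0..1}. diffeomorphism_between \<Lambda> ((\<lambda>p. \<Phi> (t, p)) ` \<Lambda>) (\<lambda>p. \<Phi> (t :: real, p))"
      "(\<lambda>p. \<Phi> (1, p)) ` \<Lambda> = \<Lambda>'"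
    using assms unfolding legendrian_isotopic_def by auto
  have "diffeomorphism_between \<Lambda> ((\<lambda>p. \<Phi> (1, p)) ` \<Lambda>) (\<lambda>p. \<Phi> (1, p))"
    using \<Phi>(1) by (rule bspec) simp
  then show ?thesis
    unfolding \<Phi>(2) diffeomorphism_between_def homeomorphic_def by auto
qed

lemma not_isotopic_ball_shell:
  assumes "CARD('n::finite) > 1"
  shows "\<not> legendrian_isotopic ball_legendrian (shell_legendrian (e :: real ^ 'n))"
proof
  assume "legendrian_isotopic ball_legendrian (shell_legendrian e)"
  from legendrian_isotopic_imp_homeomorphic[OF this]
  have "(ball_legendrian :: 'n std set) homeomorphic shell_legendrian e" .
  then have "{(x :: real ^ 'n, \<eta>). \<eta>\<^sup>2 = ball_fun 9 x} homeomorphic {(x, \<eta>). \<eta>\<^sup>2 = shell_fun e x}"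
    using legendrian_lift_homeomorphic[OF smooth_ball_fun ball_regular ball_double_topology(1)[OF assms]]
      legendrian_lift_homeomorphic[OF smooth_shell_fun shell_regular shell_double_topology(1)[OF assms]]
    by (meson homeomorphic_sym homeomorphic_trans)
  then show False
    using homeomorphic_simply_connected_eq ball_double_topology(4)[OF assms]
      shell_double_topology(4)[OF assms, of e] by blast
qed

section \<open>Failure of anti-symmetry\<close>

lemma legendrian_isotopic_refl:
  assumes "legendrian \<Lambda>"
  shows "legendrian_isotopic \<Lambda> \<Lambda>"
proof -
  have "diffeomorphism_between \<Lambda> \<Lambda> (\<lambda>p. p)"
    unfolding diffeomorphism_between_def
    by (rule exI[of _ "\<lambda>p. p"])
      (simp add: homeomorphism_ident smooth_on_open_imp_map_on[OF smooth_on_open_ident[OF open_UNIV]])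
  moreover have "smooth_map_on ({0..1} \<times> \<Lambda>) (\<lambda>p :: real \<times> _. snd p)"
    by (rule smooth_on_open_imp_map_on[OF smooth_on_open_linear[OF open_UNIV bounded_linear_snd]]) simp
  ultimately show ?thesis
    unfolding legendrian_isotopic_def using assms by (intro exI[of _ snd]) simp
qed

theorem mainTheorem3:
  assumes "CARD('n::finite) > 1"
  shows "\<not> (\<forall>\<Lambda>m \<Lambda>p :: 'n std set.
              (\<Lambda>m, \<Lambda>p) \<in> cobordism_rel \<and> (\<Lambda>p, \<Lambda>m) \<in> cobordism_rel \<longrightarrow>
              legendrian_isotopic \<Lambda>m \<Lambda>p) \<and>
         \<not> antisym (class_cobordism_rel :: 'n std set set rel) \<and>
         \<not> partial_order_on legendrian_isotopy_classes
              (class_cobordism_rel :: 'n std set set rel)"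
proof -
  obtain e :: "real ^ 'n" where e: "norm e = 1" using vector_choose_size[of 1] by auto
  define D :: "'n std set" where "D = ball_legendrian"
  define S where "S = shell_legendrian e"
  have D: "closed_connected_legendrian D"
    unfolding D_def
    by (intro closed_connected_legendrian_lift smooth_ball_fun ball_fun_derivative ball_regular
        ball_double_topology[OF assms])
  have S: "closed_connected_legendrian S"
    unfolding S_def
    by (intro closed_connected_legendrian_lift smooth_shell_fun shell_fun_derivative shell_regular
        shell_double_topology[OF assms])
  have DS: "(D, S) \<in> cobordism_rel" and SD: "(S, D) \<in> cobordism_rel"
    using D S cobordism_ball_shell[OF e] cobordism_shell_ball[OF e]
    by (auto simp: cobordism_rel_def D_def S_def)
  have not_iso: "\<not> legendrian_isotopic D S"
    unfolding D_def S_def by (rule not_isotopic_ball_shell[OF assms])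
  have refl: "(D, D) \<in> legendrian_isotopy_rel" "(S, S) \<in> legendrian_isotopy_rel"
    using D S legendrian_isotopic_refl
    by (auto simp: legendrian_isotopy_rel_def closed_connected_legendrian_def)
  define cD where "cD = legendrian_isotopy_rel `` {D}"
  define cS where "cS = legendrian_isotopy_rel `` {S}"
  have mem: "D \<in> cD" "S \<in> cS" using refl by (auto simp: cD_def cS_def)
  have cls: "cD \<in> legendrian_isotopy_classes" "cS \<in> legendrian_isotopy_classes"
    using D S by (auto simp: cD_def cS_def legendrian_isotopy_classes_def intro: quotientI)
  have "(cD, cS) \<in> class_cobordism_rel" "(cS, cD) \<in> class_cobordism_rel"
    using mem cls DS SD unfolding class_cobordism_rel_def by blast+
  moreover have "cD \<noteq> cS"
  proof
    assume "cD = cS"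
    with mem(2) have "S \<in> cD" by simp
    then have "(D, S) \<in> legendrian_isotopy_rel" by (simp add: cD_def)
    then show False using not_iso by (simp add: legendrian_isotopy_rel_def)
  qed
  ultimately have "\<not> antisym (class_cobordism_rel :: 'n std set set rel)"
    by (auto dest: antisymD)
  then show ?thesis
    using DS SD not_iso by (auto simp: partial_order_on_def)
qed

end
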